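(* Let $\alpha\geq 0$ and let $p\neq 1$ be a positive integer. For $\lambda\in(0,1)$ let $$W_\lambda(x)=\sqrt{2}\sum_{j=0}^\infty\lambda^j\sin(p^j\pi x),$$ and for a sequence $\{\lambda_n\}_{n=1}^\infty\in(0,p^{-\alpha})^\infty$ let $$w_n(x)=\frac{1}{n^\alpha}W_{\lambda_n}(nx),\qquad n\in\mathbb{N}.$$ Then $\{w_n\}_{n=1}^\infty$ is a Riesz basis of $\mathrm{H}^\alpha$ for all $\{\lambda_n\}\in\mathtt{S}_0\cup\mathtt{S}_1$, where $$\mathtt{S}_0=\left\{\{\lambda_n\}\in\left(0,\frac{1}{2p^\alpha}\right)^\infty:\ \sup_n\lambda_n<\frac{1}{2p^\alpha}\right\}$$ and $$\mathtt{S}_1=\left\{\{\lambda_n\}\in\left(0,\frac{1}{p^\alpha}\right)^\infty:\ \sup_n\lambda_n<\frac{1}{p^\alpha}\ \text{ and }\ \lambda_n=\lambda_{pn}\ \ \forall n\in\mathbb{N}\right\}.$$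
   Context: For $\alpha\geq0$, $\mathrm{H}^\alpha=\mathrm{H}^\alpha(0,1)$ denotes the Hilbert space of functions $f\in L^2(0,1)$ with $\sum_{n=1}^\infty n^{2\alpha}|\hat f(n)|^2<\infty$, where $\hat f(n)=\sqrt2\int_0^1f(x)\sin(n\pi x)\,dx$, with inner product $\langle f,g\rangle_\alpha=\sum_{n=1}^\infty n^{2\alpha}\hat f(n)\overline{\hat g(n)}$; it is considered over the complex field. The functions $h_n(x)=\frac{\sqrt2}{n^\alpha}\sin(n\pi x)$ form an orthonormal basis of $\mathrm{H}^\alpha$. A Riesz basis of a Hilbert space is the image of an orthonormal basis under a bounded operator with bounded inverse. For a set $J$, $J^\infty$ denotes the set of sequences $\{s_n\}_{n=1}^\infty$ with $s_n\in J$. *)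

theory Defs
  imports "HOL-Analysis.Analysis"
begin

abbreviation unit_leb :: "real measure" where
  "unit_leb \<equiv> lebesgue_on {0<..<1}"

definition square_integrable :: "(real \<Rightarrow> complex) \<Rightarrow> bool" where
  "square_integrable f \<longleftrightarrow>
     f \<in> borel_measurable unit_leb \<and> integrable unit_leb (\<lambda>x. (cmod (f x))\<^sup>2)"

definition L2_eq :: "(real \<Rightarrow> complex) \<Rightarrow> (real \<Rightarrow> complex) \<Rightarrow> bool" where
  "L2_eq f g \<longleftrightarrow>
     square_integrable f \<and> square_integrable g \<and> (AE x in unit_leb. f x = g x)"

lemma square_integrable_zero: "square_integrable (\<lambda>x. 0)"
  by (simp add: square_integrable_def)

lemma square_integrable_scale:
  "square_integrable f \<Longrightarrow> square_integrable (\<lambda>x. c * f x)"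
  by (auto simp: square_integrable_def norm_mult power_mult_distrib)

lemma square_integrable_add:
  assumes "square_integrable f" "square_integrable g"
  shows "square_integrable (\<lambda>x. f x + g x)"
proof -
  have m [measurable]: "f \<in> borel_measurable unit_leb" "g \<in> borel_measurable unit_leb"
    using assms by (auto simp: square_integrable_def)
  have "integrable unit_leb (\<lambda>x. 2 * (cmod (f x))\<^sup>2 + 2 * (cmod (g x))\<^sup>2)"
    using assms by (auto simp: square_integrable_def)
  then have "integrable unit_leb (\<lambda>x. (cmod (f x + g x))\<^sup>2)"
  proof (rule Bochner_Integration.integrable_bound)
    show "AE x in unit_leb. norm ((cmod (f x + g x))\<^sup>2)
            \<le> norm (2 * (cmod (f x))\<^sup>2 + 2 * (cmod (g x))\<^sup>2)"
    proof (intro AE_I2)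
      fix x
      have "(cmod (f x + g x))\<^sup>2 \<le> (cmod (f x) + cmod (g x))\<^sup>2"
        by (intro power_mono norm_triangle_ineq norm_ge_zero)
      also have "\<dots> \<le> 2 * (cmod (f x))\<^sup>2 + 2 * (cmod (g x))\<^sup>2"
        using sum_squares_bound[of "cmod (f x)" "cmod (g x)"]
        by (simp add: power2_sum)
      finally show "norm ((cmod (f x + g x))\<^sup>2)
            \<le> norm (2 * (cmod (f x))\<^sup>2 + 2 * (cmod (g x))\<^sup>2)" by simp
    qed
  qed measurable
  then show ?thesis by (simp add: square_integrable_def)
qed

quotient_type l2 = "real \<Rightarrow> complex" / partial: L2_eq
proof (rule part_equivpI)
  show "\<exists>f. L2_eq f f"
    using square_integrable_zero by (auto simp: L2_eq_def)
  show "symp L2_eq"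
    by (auto simp: symp_def L2_eq_def)
  show "transp L2_eq"
    unfolding transp_def L2_eq_def by (auto elim: AE_mp)
qed

instantiation l2 :: ab_group_add
begin

lift_definition zero_l2 :: l2 is "\<lambda>x. 0"
  by (simp add: L2_eq_def square_integrable_zero)

lift_definition plus_l2 :: "l2 \<Rightarrow> l2 \<Rightarrow> l2" is "\<lambda>f g x. f x + g x"
  by (auto simp: L2_eq_def square_integrable_add)

lift_definition uminus_l2 :: "l2 \<Rightarrow> l2" is "\<lambda>f x. - f x"
  using square_integrable_scale[of _ "-1"] by (auto simp: L2_eq_def)

definition minus_l2 :: "l2 \<Rightarrow> l2 \<Rightarrow> l2" where
  "minus_l2 f g = f + (- g)"

instance
proof
  fix a b c :: l2
  show "a + b + c = a + (b + c)"
    by transfer (auto simp: L2_eq_def add.assoc intro!: square_integrable_add)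
  show "a + b = b + a"
    by transfer (auto simp: L2_eq_def add.commute intro!: square_integrable_add)
  show "0 + a = a"
    by transfer (auto simp: L2_eq_def)
  show "- a + a = 0"
    by transfer (auto simp: L2_eq_def square_integrable_zero)
  show "a - b = a + - b"
    by (fact minus_l2_def)
qed

end

lift_definition scale_l2 :: "complex \<Rightarrow> l2 \<Rightarrow> l2" is "\<lambda>c f x. c * f x"
  by (auto simp: L2_eq_def square_integrable_scale)

lemma vector_space_l2: "vector_space scale_l2"
proof
  fix a b :: complex and x y :: l2
  show "scale_l2 a (x + y) = scale_l2 a x + scale_l2 a y"
    by transfer (auto simp: L2_eq_def algebra_simps
        intro!: square_integrable_add square_integrable_scale)
  show "scale_l2 (a + b) x = scale_l2 a x + scale_l2 b x"
    by transfer (auto simp: L2_eq_def distrib_right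
        intro!: square_integrable_add square_integrable_scale)
  show "scale_l2 a (scale_l2 b x) = scale_l2 (a * b) x"
    by transfer (auto simp: L2_eq_def mult.assoc intro!: square_integrable_scale)
  show "scale_l2 1 x = x"
    by transfer (auto simp: L2_eq_def)
qed

lift_definition sine_coeff :: "l2 \<Rightarrow> nat \<Rightarrow> complex" is
  "\<lambda>f n. complex_of_real (sqrt 2) *
     (\<integral>x. f x * complex_of_real (sin (real n * pi * x)) \<partial>unit_leb)"
proof (rule ext)
  fix f g :: "real \<Rightarrow> complex" and n :: nat
  assume fg: "L2_eq f g"
  have [measurable]: "(\<lambda>x. sin (real n * pi * x)) \<in> borel_measurable unit_leb"
    by (intro measurable_restrict_space1 borel_measurable_continuous_onI continuous_intros
          measurable_completion) auto
  have [measurable]: "f \<in> borel_measurable unit_leb" "g \<in> borel_measurable unit_leb"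
    using fg by (auto simp: L2_eq_def square_integrable_def)
  have "(\<integral>x. f x * complex_of_real (sin (real n * pi * x)) \<partial>unit_leb)
      = (\<integral>x. g x * complex_of_real (sin (real n * pi * x)) \<partial>unit_leb)"
    using fg by (intro integral_cong_AE) (auto simp: L2_eq_def)
  then show "complex_of_real (sqrt 2) *
       (\<integral>x. f x * complex_of_real (sin (real n * pi * x)) \<partial>unit_leb)
    = complex_of_real (sqrt 2) *
       (\<integral>x. g x * complex_of_real (sin (real n * pi * x)) \<partial>unit_leb)"
    by simp
qed

definition H :: "real \<Rightarrow> l2 set" where
  "H \<alpha> = {f. (\<lambda>n. real n powr (2 * \<alpha>) * (cmod (sine_coeff f n))\<^sup>2) summable_on {1..}}"

definition H_inner :: "real \<Rightarrow> l2 \<Rightarrow> l2 \<Rightarrow> complex" where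
  "H_inner \<alpha> f g = (\<Sum>\<^sub>\<infinity>n\<in>{1..}. complex_of_real (real n powr (2 * \<alpha>)) *
     sine_coeff f n * cnj (sine_coeff g n))"

text \<open>
  The notions below refer to a complex inner product space with carrier \<open>V\<close>, scalar
  multiplication \<open>sc\<close> and inner product \<open>ip\<close>.  Sequences are indexed by the positive
  integers; their value at \<open>0\<close> is ignored.
\<close>

definition ip_norm :: "('v \<Rightarrow> 'v \<Rightarrow> complex) \<Rightarrow> 'v \<Rightarrow> real" where
  "ip_norm ip x = sqrt (Re (ip x x))"

definition orthonormal_basis ::
    "(complex \<Rightarrow> 'v \<Rightarrow> 'v) \<Rightarrow> 'v::ab_group_add set \<Rightarrow> ('v \<Rightarrow> 'v \<Rightarrow> complex) \<Rightarrow> (nat \<Rightarrow> 'v) \<Rightarrow> bool" where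
  "orthonormal_basis sc V ip e \<longleftrightarrow>
     (\<forall>n\<ge>1. e n \<in> V) \<and>
     (\<forall>m\<ge>1. \<forall>n\<ge>1. ip (e m) (e n) = (if m = n then 1 else 0)) \<and>
     (\<forall>x\<in>V. \<forall>\<epsilon>>0. \<exists>N c. ip_norm ip (x - (\<Sum>n=1..N. sc (c n) (e n))) < \<epsilon>)"

definition bounded_operator_on ::
    "(complex \<Rightarrow> 'v \<Rightarrow> 'v) \<Rightarrow> 'v::ab_group_add set \<Rightarrow> ('v \<Rightarrow> 'v \<Rightarrow> complex) \<Rightarrow> ('v \<Rightarrow> 'v) \<Rightarrow> bool" where
  "bounded_operator_on sc V ip T \<longleftrightarrow>
     (\<forall>x\<in>V. T x \<in> V) \<and>
     (\<forall>x\<in>V. \<forall>y\<in>V. T (x + y) = T x + T y) \<and>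
     (\<forall>c. \<forall>x\<in>V. T (sc c x) = sc c (T x)) \<and>
     (\<exists>K. \<forall>x\<in>V. ip_norm ip (T x) \<le> K * ip_norm ip x)"

definition riesz_basis ::
    "(complex \<Rightarrow> 'v \<Rightarrow> 'v) \<Rightarrow> 'v::ab_group_add set \<Rightarrow> ('v \<Rightarrow> 'v \<Rightarrow> complex) \<Rightarrow> (nat \<Rightarrow> 'v) \<Rightarrow> bool" where
  "riesz_basis sc V ip w \<longleftrightarrow>
     (\<exists>e T S. orthonormal_basis sc V ip e \<and>
        bounded_operator_on sc V ip T \<and> bounded_operator_on sc V ip S \<and>
        (\<forall>x\<in>V. S (T x) = x \<and> T (S x) = x) \<and>
        (\<forall>n\<ge>1. w n = T (e n)))"

definition W :: "nat \<Rightarrow> real \<Rightarrow> real \<Rightarrow> real" where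
  "W p l x = sqrt 2 * (\<Sum>j. l ^ j * sin (real (p ^ j) * pi * x))"

definition w_fun :: "nat \<Rightarrow> real \<Rightarrow> (nat \<Rightarrow> real) \<Rightarrow> nat \<Rightarrow> real \<Rightarrow> complex" where
  "w_fun p \<alpha> lam n x = complex_of_real (1 / real n powr \<alpha> * W p (lam n) (real n * x))"

definition w :: "nat \<Rightarrow> real \<Rightarrow> (nat \<Rightarrow> real) \<Rightarrow> nat \<Rightarrow> l2" where
  "w p \<alpha> lam n = abs_l2 (w_fun p \<alpha> lam n)"

text \<open>\<open>abs_l2\<close> is only meaningful on square-integrable functions.\<close>

lemma continuous_W:
  assumes "0 < l" "l < 1"
  shows "continuous_on UNIV (W p l)"
proof -
  have "uniform_limit UNIV (\<lambda>N x. \<Sum>j<N. l ^ j * sin (real (p ^ j) * pi * x))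
          (\<lambda>x. \<Sum>j. l ^ j * sin (real (p ^ j) * pi * x)) sequentially"
  proof (rule Weierstrass_m_test)
    show "norm (l ^ j * sin (real (p ^ j) * pi * x)) \<le> l ^ j" for j x
      using assms by (simp add: abs_mult mult_left_le)
    show "summable (\<lambda>j. l ^ j)"
      using assms by (simp add: summable_geometric)
  qed
  then have "continuous_on UNIV (\<lambda>x. \<Sum>j. l ^ j * sin (real (p ^ j) * pi * x))"
    by (rule uniform_limit_theorem[rotated]) (auto intro!: always_eventually continuous_intros)
  then show ?thesis
    unfolding W_def[abs_def] by (intro continuous_intros)
qed

lemma square_integrable_w_fun:
  assumes "0 < lam n" "lam n < 1"
  shows "square_integrable (w_fun p \<alpha> lam n)"
proof -
  have W: "continuous_on UNIV (W p (lam n))"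
    using assms by (rule continuous_W)
  have c: "continuous_on UNIV (w_fun p \<alpha> lam n)"
    unfolding w_fun_def[abs_def]
    by (intro continuous_intros continuous_on_compose2[OF W]) auto
  have "(\<lambda>x. (cmod (w_fun p \<alpha> lam n x))\<^sup>2) absolutely_integrable_on {0..1}"
    by (intro absolutely_integrable_continuous_real continuous_intros
        continuous_on_subset[OF c]) auto
  then have "(\<lambda>x. (cmod (w_fun p \<alpha> lam n x))\<^sup>2) absolutely_integrable_on {0<..<1}"
    by (rule set_integrable_subset) auto
  then have "integrable unit_leb (\<lambda>x. (cmod (w_fun p \<alpha> lam n x))\<^sup>2)"
    by (simp add: integrable_restrict_space set_integrable_def)
  moreover have "w_fun p \<alpha> lam n \<in> borel_measurable unit_leb"
    by (intro measurable_restrict_space1 measurable_completion)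
       (use borel_measurable_continuous_onI[OF c] in auto)
  ultimately show ?thesis
    by (simp add: square_integrable_def)
qed

text \<open>
  Since only the entries at \<open>n \<ge> 1\<close> matter, all suprema below are of nonempty bounded sets of reals.
\<close>

definition seqs :: "real set \<Rightarrow> (nat \<Rightarrow> real) set" where
  "seqs J = {s. \<forall>n\<ge>1. s n \<in> J}"

definition S0 :: "nat \<Rightarrow> real \<Rightarrow> (nat \<Rightarrow> real) set" where
  "S0 p \<alpha> = {lam \<in> seqs {0<..<1 / (2 * real p powr \<alpha>)}.
     (SUP n\<in>{1..}. lam n) < 1 / (2 * real p powr \<alpha>)}"

definition S1 :: "nat \<Rightarrow> real \<Rightarrow> (nat \<Rightarrow> real) set" where
  "S1 p \<alpha> = {lam \<in> seqs {0<..<1 / real p powr \<alpha>}.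
     (SUP n\<in>{1..}. lam n) < 1 / real p powr \<alpha> \<and> (\<forall>n\<ge>1. lam n = lam (p * n))}"

end

theory Submission
  imports Defs
begin

text \<open>
  In the coordinates \<open>n powr \<alpha> * sine_coeff f n\<close> the vector \<open>w n\<close> is the image of the \<open>n\<close>-th unit
  vector under \<open>\<Phi> a m = (\<Sum>p ^ j dvd m. \<mu> (m / p ^ j) ^ j * a (m / p ^ j))\<close> with
  \<open>\<mu> n = p powr \<alpha> * lam n\<close>.  This \<open>\<Phi>\<close> is lower unitriangular, hence a bijection of all sequences, and
  it remains to bound \<open>\<Phi>\<close> and its inverse.  The \<open>j\<close>-th summand has norm at most \<open>s ^ j\<close>, where
  \<open>s = (SUP n. \<mu> n) < 1\<close>.  In case \<open>S0\<close> this makes \<open>\<Phi>\<close> a perturbation of the identity of norm at most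
  \<open>s / (1 - s) < 1\<close>.  In case \<open>S1\<close> the summands are the powers of the first one, \<open>R\<close>, so that the
  inverse of \<open>\<Phi>\<close> is \<open>1 - R\<close>.  By triangularity all estimates hold for the norms truncated
  to \<open>{1..N}\<close>, which avoids any convergence question in the sequence space.
\<close>

section \<open>Dilation operators on sequences\<close>

definition trunc_norm :: "nat \<Rightarrow> (nat \<Rightarrow> complex) \<Rightarrow> real" where
  "trunc_norm N a = L2_set (\<lambda>n. cmod (a n)) {1..N}"

lemma trunc_norm_nonneg [simp]: "0 \<le> trunc_norm N a"
  by (simp add: trunc_norm_def)

lemma trunc_norm_cong: "(\<And>n. n \<in> {1..N} \<Longrightarrow> a n = b n) \<Longrightarrow> trunc_norm N a = trunc_norm N b"
  unfolding trunc_norm_def by (intro L2_set_cong) auto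

lemma trunc_norm_add: "trunc_norm N (\<lambda>n. a n + b n) \<le> trunc_norm N a + trunc_norm N b"
  unfolding trunc_norm_def
  by (rule order_trans[OF L2_set_mono L2_set_triangle_ineq]) (auto simp: norm_triangle_ineq)

lemma trunc_norm_uminus: "trunc_norm N (\<lambda>n. - a n) = trunc_norm N a"
  by (simp add: trunc_norm_def)

lemma trunc_norm_diff: "trunc_norm N (\<lambda>n. a n - b n) \<le> trunc_norm N a + trunc_norm N b"
  using trunc_norm_add[of N a "\<lambda>n. - b n"] by (simp add: trunc_norm_uminus)

lemma trunc_norm_sum:
  "finite J \<Longrightarrow> trunc_norm N (\<lambda>n. \<Sum>j\<in>J. f j n) \<le> (\<Sum>j\<in>J. trunc_norm N (f j))"
proof (induction J rule: finite_induct)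
  case empty
  then show ?case by (simp add: trunc_norm_def L2_set_def)
next
  case (insert j J)
  then show ?case
    using trunc_norm_add[of N "f j" "\<lambda>n. \<Sum>j\<in>J. f j n"] by simp
qed

text \<open>For \<open>p \<ge> 2\<close> and \<open>n \<ge> 1\<close> the \<open>n\<close>-th unit
  vector goes to \<open>\<mu> n ^ j\<close> times the unit vector at \<open>p ^ j * n\<close>. The
  weight is the \<open>j\<close>-th power taken at the source index, not a product along the orbit,
  so in general these operators are not the powers of a single one.\<close>

definition dilate :: "nat \<Rightarrow> (nat \<Rightarrow> real) \<Rightarrow> nat \<Rightarrow> (nat \<Rightarrow> complex) \<Rightarrow> nat \<Rightarrow> complex" where
  "dilate p \<mu> j a m =
     (if p ^ j dvd m then complex_of_real (\<mu> (m div p ^ j) ^ j) * a (m div p ^ j) else 0)"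

lemma dilate_0 [simp]: "dilate p \<mu> 0 a = a"
  by (auto simp: dilate_def)

lemma dilate_add: "dilate p \<mu> j (\<lambda>n. a n + b n) m = dilate p \<mu> j a m + dilate p \<mu> j b m"
  by (simp add: dilate_def distrib_left)

lemma dilate_scale: "dilate p \<mu> j (\<lambda>n. c * a n) m = c * dilate p \<mu> j a m"
  by (simp add: dilate_def)

lemma dilate_sum: "dilate p \<mu> j (\<lambda>n. \<Sum>i\<in>I. f i n) m = (\<Sum>i\<in>I. dilate p \<mu> j (f i) m)"
  by (simp add: dilate_def sum_distrib_left)

text \<open>Since \<open>j < 2 ^ j \<le> p ^ j\<close>, a positive \<open>m \<le> j\<close> is too
  small to be a multiple of \<open>p ^ j\<close>. Hence only finitely many dilations contribute to
  each entry.\<close>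

lemma dilate_eq_0:
  assumes "p \<ge> 2" "m \<ge> 1" "m \<le> j"
  shows "dilate p \<mu> j a m = 0"
proof -
  have "j < 2 ^ j" by simp
  also have "\<dots> \<le> p ^ j" using assms by (simp add: power_mono)
  finally have "\<not> p ^ j dvd m" using assms by (meson dvd_imp_le leD le_trans less_le_trans not_le zero_less_one)
  then show ?thesis by (simp add: dilate_def)
qed

text \<open>On the multiples of \<open>p ^ j\<close> the map \<open>m \<mapsto> m div p ^ j\<close>
  is injective, so the dilated sequence is a rearrangement of some entries of \<open>a\<close>, each
  multiplied by at most \<open>s ^ j\<close>.\<close>

lemma trunc_norm_dilate:
  assumes p: "p \<ge> 2" and s: "\<And>n. n \<ge> 1 \<Longrightarrow> 0 \<le> \<mu> n \<and> \<mu> n \<le> s"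
  shows "trunc_norm N (dilate p \<mu> j a) \<le> s ^ j * trunc_norm N a"
proof -
  let ?M = "{m\<in>{1..N}. p ^ j dvd m}"
  have s0: "0 \<le> s" using s[of 1] by linarith
  have pos: "m div p ^ j \<ge> 1" if "m \<in> ?M" for m
    using that p by (auto simp: Suc_le_eq div_greater_zero_iff intro: dvd_imp_le)
  have "(\<Sum>m\<in>{1..N}. (cmod (dilate p \<mu> j a m))\<^sup>2) = (\<Sum>m\<in>?M. (cmod (dilate p \<mu> j a m))\<^sup>2)"
    by (rule sum.mono_neutral_right) (auto simp: dilate_def)
  also have "\<dots> \<le> (\<Sum>m\<in>?M. (s ^ j * cmod (a (m div p ^ j)))\<^sup>2)"
  proof (intro sum_mono power_mono)
    fix m assume m: "m \<in> ?M"
    have "\<mu> (m div p ^ j) ^ j \<le> s ^ j" "0 \<le> \<mu> (m div p ^ j) ^ j"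
      using s[OF pos[OF m]] by (auto intro: power_mono)
    moreover have "cmod (dilate p \<mu> j a m) = \<bar>\<mu> (m div p ^ j) ^ j\<bar> * cmod (a (m div p ^ j))"
      using m by (simp add: dilate_def norm_mult norm_power power_abs)
    ultimately show "cmod (dilate p \<mu> j a m) \<le> s ^ j * cmod (a (m div p ^ j))"
      by (simp add: mult_right_mono)
  qed simp
  also have "\<dots> = (\<Sum>k\<in>(\<lambda>m. m div p ^ j) ` ?M. (s ^ j * cmod (a k))\<^sup>2)"
  proof (subst sum.reindex)
    show "inj_on (\<lambda>m. m div p ^ j) ?M"
      by (rule inj_onI) (metis (mono_tags, lifting) dvd_div_mult_self mem_Collect_eq)
  qed simp
  \<comment> \<open>Source indices never exceed target indices; this triangularity allows the same
    \<open>N\<close> on both sides.\<close>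
  also have "\<dots> \<le> (\<Sum>k\<in>{1..N}. (s ^ j * cmod (a k))\<^sup>2)"
  proof (intro sum_mono2 subsetI)
    fix k assume "k \<in> (\<lambda>m. m div p ^ j) ` ?M"
    then obtain m where m: "m \<in> ?M" "k = m div p ^ j" by blast
    have "m div p ^ j \<le> N"
      by (rule order_trans[OF div_le_dividend]) (use m in simp)
    then show "k \<in> {1..N}" using m pos[OF m(1)] by simp
  qed auto
  finally have "trunc_norm N (dilate p \<mu> j a) \<le> L2_set (\<lambda>k. s ^ j * cmod (a k)) {1..N}"
    by (simp add: trunc_norm_def L2_set_def)
  also have "\<dots> = s ^ j * trunc_norm N a"
    using s0 by (simp add: trunc_norm_def L2_set_right_distrib)
  finally show ?thesis .
qed

text \<open>For \<open>m \<ge> 1\<close> the cutoff \<open>j \<le> m\<close> loses nothing by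
  \<open>dilate_eq_0\<close>. At \<open>m = 0\<close>, where no dilation vanishes for divisibility
  reasons, it leaves just the value \<open>a 0\<close>.\<close>

definition dilation_series :: "nat \<Rightarrow> (nat \<Rightarrow> real) \<Rightarrow> (nat \<Rightarrow> complex) \<Rightarrow> nat \<Rightarrow> complex" where
  "dilation_series p \<mu> a m = (\<Sum>j\<le>m. dilate p \<mu> j a m)"

text \<open>A cutoff common to all \<open>m\<close> in \<open>{1..N}\<close> makes the series a
  finite sum of sequences, to which \<open>trunc_norm_sum\<close> applies.\<close>

lemma dilation_series_eq:
  assumes "p \<ge> 2" "1 \<le> m" "m \<le> N"
  shows "dilation_series p \<mu> a m = (\<Sum>j\<le>N. dilate p \<mu> j a m)"
  unfolding dilation_series_def using assms
  by (intro sum.mono_neutral_left) (auto simp: dilate_eq_0)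

lemma dilation_series_add:
  "dilation_series p \<mu> (\<lambda>n. a n + b n) m = dilation_series p \<mu> a m + dilation_series p \<mu> b m"
  by (simp add: dilation_series_def dilate_add sum.distrib)

lemma dilation_series_scale:
  "dilation_series p \<mu> (\<lambda>n. c * a n) m = c * dilation_series p \<mu> a m"
  by (simp add: dilation_series_def dilate_scale sum_distrib_left)

lemma geometric_partial_sum_le:
  fixes s :: real
  assumes "0 \<le> s" "s < 1"
  shows "(\<Sum>j\<le>N. s ^ j) \<le> 1 / (1 - s)"
proof -
  have "(\<Sum>j\<le>N. s ^ j) = (1 - s ^ Suc N) / (1 - s)"
    using assms by (simp only: sum_gp0) auto
  also have "\<dots> \<le> 1 / (1 - s)"
    using assms by (intro divide_right_mono) auto
  finally show ?thesis .
qed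

lemma trunc_norm_dilation_series:
  assumes p: "p \<ge> 2" and s: "\<And>n. n \<ge> 1 \<Longrightarrow> 0 \<le> \<mu> n \<and> \<mu> n \<le> s" and "s < 1"
  shows "trunc_norm N (dilation_series p \<mu> a) \<le> 1 / (1 - s) * trunc_norm N a"
proof -
  have "trunc_norm N (dilation_series p \<mu> a) = trunc_norm N (\<lambda>m. \<Sum>j\<le>N. dilate p \<mu> j a m)"
    by (intro trunc_norm_cong dilation_series_eq p) auto
  also have "\<dots> \<le> (\<Sum>j\<le>N. trunc_norm N (dilate p \<mu> j a))"
    by (rule trunc_norm_sum) simp
  also have "\<dots> \<le> (\<Sum>j\<le>N. s ^ j * trunc_norm N a)"
    by (intro sum_mono trunc_norm_dilate p s)
  also have "\<dots> \<le> 1 / (1 - s) * trunc_norm N a"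
    unfolding sum_distrib_right[symmetric] using s[of 1] \<open>s < 1\<close>
    by (intro mult_right_mono geometric_partial_sum_le) auto
  finally show ?thesis .
qed

text \<open>The terms with \<open>j \<ge> 1\<close> have total norm at most
  \<open>s / (1 - s)\<close>, which is below 1 exactly because \<open>s < 1 / 2\<close>. They can be
  absorbed into the left-hand side, and the constant is the reciprocal of
  \<open>1 - s / (1 - s)\<close>.\<close>

lemma trunc_norm_le_dilation_series_small:
  assumes p: "p \<ge> 2" and s: "\<And>n. n \<ge> 1 \<Longrightarrow> 0 \<le> \<mu> n \<and> \<mu> n \<le> s" and s1: "s < 1 / 2"
  shows "trunc_norm N a \<le> (1 - s) / (1 - 2 * s) * trunc_norm N (dilation_series p \<mu> a)"
proof -
  let ?t = "trunc_norm N a" and ?d = "trunc_norm N (dilation_series p \<mu> a)"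
  have s0: "0 \<le> s" using s[of 1] by linarith
  let ?R = "\<lambda>m. \<Sum>j=1..N. dilate p \<mu> j a m"
  have split: "{..N} = insert 0 {1..N}" by auto
  have "?t = trunc_norm N (\<lambda>m. dilation_series p \<mu> a m - ?R m)"
    by (intro trunc_norm_cong) (auto simp: dilation_series_eq[OF p, of _ N] split)
  also have "\<dots> \<le> ?d + trunc_norm N ?R"
    by (rule trunc_norm_diff)
  also have "trunc_norm N ?R \<le> (\<Sum>j=1..N. trunc_norm N (dilate p \<mu> j a))"
    by (rule trunc_norm_sum) simp
  also have "\<dots> \<le> (\<Sum>j=1..N. s ^ j * ?t)"
    by (intro sum_mono trunc_norm_dilate p s)
  also have "\<dots> = ((\<Sum>j\<le>N. s ^ j) - 1) * ?t"
    unfolding sum_distrib_right[symmetric] by (simp add: split)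
  also have "\<dots> \<le> (1 / (1 - s) - 1) * ?t"
    using geometric_partial_sum_le[of s N] s0 s1 by (intro mult_right_mono) auto
  finally have "(2 - 1 / (1 - s)) * ?t \<le> ?d" by (simp add: algebra_simps)
  moreover have "2 - 1 / (1 - s) = (1 - 2 * s) / (1 - s)" using s1 by (simp add: field_simps)
  ultimately show ?thesis using s1 s0 by (simp add: field_simps)
qed

text \<open>At \<open>m = p ^ Suc j * k\<close> the composition has weight
  \<open>\<mu> (p ^ j * k) * \<mu> k ^ j\<close>. Invariance of \<open>\<mu>\<close> along the orbit
  of \<open>k\<close> turns this into \<open>\<mu> k ^ Suc j\<close>.\<close>

lemma dilate_1_dilate:
  assumes p: "p \<ge> 2" and inv: "\<And>n. n \<ge> 1 \<Longrightarrow> \<mu> n = \<mu> (p * n)" and m: "m \<ge> 1"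
  shows "dilate p \<mu> 1 (dilate p \<mu> j a) m = dilate p \<mu> (Suc j) a m"
proof (cases "p ^ Suc j dvd m")
  case True
  then obtain k where k: "m = p ^ Suc j * k" by (elim dvdE)
  then have k1: "k \<ge> 1" using m by (cases k) auto
  have "\<mu> (p ^ j * k) = \<mu> k" for j
  proof (induction j)
    case (Suc j)
    have "\<mu> (p * (p ^ j * k)) = \<mu> (p ^ j * k)"
      using k1 p by (intro inv[symmetric]) (simp add: Suc_le_eq)
    with Suc show ?case by (simp add: mult.assoc)
  qed simp
  then show ?thesis
    using k p by (simp add: dilate_def mult.assoc)
next
  case False
  have "\<not> p ^ j dvd m div p" if "p dvd m"
    using that False p by (auto simp: dvd_div_iff_mult mult.commute)
  with False show ?thesis by (auto simp: dilate_def)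
qed

text \<open>With \<open>R = dilate p \<mu> 1\<close> the series is the Neumann series of
  \<open>R\<close>. Applying \<open>1 - R\<close> telescopes it back to \<open>a\<close>, and
  \<open>1 - R\<close> has norm at most \<open>1 + s\<close>.\<close>

lemma trunc_norm_le_dilation_series_invariant:
  assumes p: "p \<ge> 2" and s: "\<And>n. n \<ge> 1 \<Longrightarrow> 0 \<le> \<mu> n \<and> \<mu> n \<le> s"
    and inv: "\<And>n. n \<ge> 1 \<Longrightarrow> \<mu> n = \<mu> (p * n)"
  shows "trunc_norm N a \<le> (1 + s) * trunc_norm N (dilation_series p \<mu> a)"
proof -
  let ?b = "\<lambda>m. \<Sum>j\<le>N. dilate p \<mu> j a m"
  have b: "trunc_norm N (dilation_series p \<mu> a) = trunc_norm N ?b"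
    by (intro trunc_norm_cong dilation_series_eq p) auto
  have "a m = ?b m - dilate p \<mu> 1 ?b m" if "m \<in> {1..N}" for m
  proof -
    have "dilate p \<mu> 1 ?b m = (\<Sum>j\<le>N. dilate p \<mu> (Suc j) a m)"
      using that by (simp only: dilate_sum) (intro sum.cong dilate_1_dilate p inv, auto)
    also have "?b m - \<dots> = dilate p \<mu> 0 a m - dilate p \<mu> (Suc N) a m"
      using sum_telescope[of "\<lambda>j. dilate p \<mu> j a m" N] by (simp add: sum_subtractf)
    \<comment> \<open>The remainder with exponent \<open>Suc N\<close> vanishes because
      \<open>m \<le> N\<close>, so no limit is taken.\<close>
    finally show ?thesis using that by (simp add: dilate_eq_0 p)
  qed
  then have "trunc_norm N a = trunc_norm N (\<lambda>m. ?b m - dilate p \<mu> 1 ?b m)"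
    by (rule trunc_norm_cong)
  also have "\<dots> \<le> trunc_norm N ?b + s ^ 1 * trunc_norm N ?b"
    by (intro order_trans[OF trunc_norm_diff] add_left_mono trunc_norm_dilate p s)
  finally show ?thesis by (simp add: b algebra_simps)
qed

text \<open>Forward substitution: for \<open>j \<ge> 1\<close> the \<open>m\<close>-th entry
  involves \<open>a\<close> only at \<open>m div p ^ j < m\<close>, so the equation determines
  \<open>a m\<close> from earlier entries.\<close>

lemma dilation_series_surj:
  assumes p: "p \<ge> 2"
  shows "\<exists>a. dilation_series p \<mu> a = b"
proof -
  \<comment> \<open>The guard \<open>(k, m) \<in> less_than\<close> makes \<open>F f m\<close>
    depend only on values of \<open>f\<close> below \<open>m\<close>, so that \<open>wfrec\<close>
    unfolds. It is removed again below.\<close>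
  define F where "F = (\<lambda>f m. b m - (\<Sum>j=1..m.
      dilate p \<mu> j (\<lambda>k. if (k, m) \<in> less_than then f k else 0) m))"
  define a where "a = wfrec less_than F"
  have a: "a m = F a m" for m
    unfolding a_def by (subst wfrec) (auto simp: F_def cut_def intro!: sum.cong arg_cong[where f="\<lambda>g. dilate p \<mu> _ g m"])
  have "dilation_series p \<mu> a m = b m" for m
  proof -
    have "dilate p \<mu> j (\<lambda>k. if (k, m) \<in> less_than then a k else 0) m = dilate p \<mu> j a m"
      if "j \<in> {1..m}" for j
    proof -
      have m: "m \<ge> 1" using that by simp
      have "p ^ 1 \<le> p ^ j" using that p by (intro power_increasing) auto
      then have "m div p ^ j < m" using m p by (intro div_less_dividend) auto
      then show ?thesis by (simp add: dilate_def)
    qed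
    then have "a m = b m - (\<Sum>j=1..m. dilate p \<mu> j a m)"
      by (subst a) (simp add: F_def)
    moreover have "{..m} = insert 0 {1..m}" by auto
    ultimately show ?thesis by (simp add: dilation_series_def)
  qed
  then show ?thesis by blast
qed

section \<open>Completeness of the sine system\<close>

lemma integrable_unit_leb_continuous:
  fixes f :: "real \<Rightarrow> 'a::euclidean_space"
  assumes "continuous_on {0..1} f"
  shows "integrable unit_leb f"
proof -
  have "f absolutely_integrable_on {0..1}"
    by (rule absolutely_integrable_continuous_real[OF assms])
  then have "f absolutely_integrable_on {0<..<1}"
    by (rule set_integrable_subset) auto
  then show ?thesis
    by (simp add: integrable_restrict_space set_integrable_def)
qed

lemma measurable_unit_leb_continuous:
  fixes f :: "real \<Rightarrow> 'a::euclidean_space"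
  assumes "continuous_on {0..1} f"
  shows "f \<in> borel_measurable unit_leb"
  using integrable_unit_leb_continuous[OF assms] by (rule borel_measurable_integrable)

lemma square_integrable_continuous:
  assumes "continuous_on {0..1} f"
  shows "square_integrable f"
  unfolding square_integrable_def using assms
  by (intro conjI measurable_unit_leb_continuous integrable_unit_leb_continuous continuous_intros)

text \<open>Domination replaces the Cauchy-Schwarz inequality: \<open>g\<close> is bounded, and
  \<open>cmod (f x) \<le> 1 + (cmod (f x))\<^sup>2\<close> is integrable on the unit
  interval.\<close>

lemma integrable_square_integrable_mult_continuous:
  assumes f: "square_integrable f" and g: "continuous_on {0..1} g"
  shows "integrable unit_leb (\<lambda>x. f x * g x)"
proof -
  have [measurable]: "f \<in> borel_measurable unit_leb" "g \<in> borel_measurable unit_leb"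
    using f measurable_unit_leb_continuous[OF g] by (auto simp: square_integrable_def)
  have "bounded (g ` {0..1})"
    by (intro compact_imp_bounded compact_continuous_image g) auto
  then obtain B where B: "\<And>x. x \<in> {0..1} \<Longrightarrow> cmod (g x) \<le> B"
    unfolding bounded_iff by blast
  have "integrable unit_leb (\<lambda>x. (1 + (cmod (f x))\<^sup>2) * B)"
    using f integrable_unit_leb_continuous[of "\<lambda>x. 1::real"]
    by (intro integrable_mult_left Bochner_Integration.integrable_add) (auto simp: square_integrable_def)
  then show ?thesis
  proof (rule Bochner_Integration.integrable_bound)
    show "AE x in unit_leb. norm (f x * g x) \<le> norm ((1 + (cmod (f x))\<^sup>2) * B)"
    proof (intro AE_I2)
      fix x assume "x \<in> space unit_leb"
      then have gB: "cmod (g x) \<le> B" by (intro B) auto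
      then have "0 \<le> B" using norm_ge_zero order_trans by blast
      have "cmod (f x) \<le> 1 + (cmod (f x))\<^sup>2"
        using zero_le_power2[of "cmod (f x) - 1 / 2"] by (simp add: power2_eq_square algebra_simps)
      then show "norm (f x * g x) \<le> norm ((1 + (cmod (f x))\<^sup>2) * B)"
        using gB \<open>0 \<le> B\<close> by (simp add: norm_mult abs_mult mult_mono)
    qed
  qed measurable
qed

text \<open>The identity 2 sin(nt) cos(t) = sin((n+1)t) + sin((n-1)t) lowers the power of the cosine
  at the cost of shifting \<open>n\<close>. The induction therefore runs over all \<open>n\<close>,
  including 0, where the sine vanishes.\<close>

lemma integral_sin_cos_power_eq_0:
  assumes g: "square_integrable g"
    and zero: "\<And>n. n \<ge> 1 \<Longrightarrow> (\<integral>x. g x * complex_of_real (sin (real n * pi * x)) \<partial>unit_leb) = 0"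
  shows "(\<integral>x. g x * complex_of_real (sin (real n * pi * x) * cos (pi * x) ^ k) \<partial>unit_leb) = 0"
proof (induction k arbitrary: n)
  case 0
  then show ?case by (cases "n = 0") (use zero[of n] in auto)
next
  case (Suc k)
  show ?case
  proof (cases n)
    case (Suc m)
    have int: "integrable unit_leb (\<lambda>x. g x * complex_of_real (sin (real i * pi * x) * cos (pi * x) ^ k))" for i
      by (intro integrable_square_integrable_mult_continuous[OF g] continuous_intros)
    have "sin (real n * pi * x) * cos (pi * x) ^ Suc k =
        sin (real (n + 1) * pi * x) * cos (pi * x) ^ k / 2 + sin (real m * pi * x) * cos (pi * x) ^ k / 2" for x
    proof -
      have "sin (real (n + 1) * pi * x) = sin (real n * pi * x + pi * x)"
        "sin (real m * pi * x) = sin (real n * pi * x - pi * x)"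
        by (auto simp: Suc algebra_simps)
      then have "sin (real (n + 1) * pi * x) + sin (real m * pi * x) = 2 * sin (real n * pi * x) * cos (pi * x)"
        by (simp add: sin_add sin_diff)
      then have "sin (real n * pi * x) * cos (pi * x) = (sin (real (n + 1) * pi * x) + sin (real m * pi * x)) / 2"
        by simp
      then show ?thesis by (simp only: power_Suc mult.assoc[symmetric]) (simp add: algebra_simps add_divide_distrib)
    qed
    then have "(\<integral>x. g x * complex_of_real (sin (real n * pi * x) * cos (pi * x) ^ Suc k) \<partial>unit_leb) =
       (\<integral>x. g x * complex_of_real (sin (real (n + 1) * pi * x) * cos (pi * x) ^ k) / 2 +
             g x * complex_of_real (sin (real m * pi * x) * cos (pi * x) ^ k) / 2 \<partial>unit_leb)"
      by (intro Bochner_Integration.integral_cong) (auto simp: algebra_simps simp del: of_nat_add)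
    also have "\<dots> = 0"
      using Suc.IH[of "n + 1"] Suc.IH[of m] int[of "n + 1"] int[of m]
      by (subst Bochner_Integration.integral_add) (auto simp del: of_nat_add of_real_mult)
    finally show ?thesis .
  qed auto
qed

text \<open>Linearity in the case \<open>n = 1\<close>. Polynomials in cos(pi x) are the right class
  since this cosine is a strictly monotone coordinate on the unit interval, which brings in the
  Weierstrass theorem.\<close>

lemma integral_sin_polynomial_cos_eq_0:
  assumes g: "square_integrable g"
    and zero: "\<And>n. n \<ge> 1 \<Longrightarrow> (\<integral>x. g x * complex_of_real (sin (real n * pi * x)) \<partial>unit_leb) = 0"
    and q: "real_polynomial_function q"
  shows "(\<integral>x. g x * complex_of_real (sin (pi * x) * q (cos (pi * x))) \<partial>unit_leb) = 0"
proof -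
  obtain a n where q: "q = (\<lambda>x. \<Sum>i\<le>n. a i * x ^ i)"
    using q by (auto simp: real_polynomial_function_iff_sum)
  have int: "integrable unit_leb (\<lambda>x. g x * complex_of_real (sin (pi * x) * cos (pi * x) ^ k))" for k
    by (intro integrable_square_integrable_mult_continuous[OF g] continuous_intros)
  have "(\<integral>x. g x * complex_of_real (sin (pi * x) * q (cos (pi * x))) \<partial>unit_leb) =
     (\<integral>x. (\<Sum>i\<le>n. complex_of_real (a i) * (g x * complex_of_real (sin (pi * x) * cos (pi * x) ^ i))) \<partial>unit_leb)"
    by (intro Bochner_Integration.integral_cong) (auto simp: q sum_distrib_left algebra_simps)
  also have "\<dots> = (\<Sum>i\<le>n. complex_of_real (a i) * (\<integral>x. g x * complex_of_real (sin (pi * x) * cos (pi * x) ^ i) \<partial>unit_leb))"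
    by (subst Bochner_Integration.integral_sum) (auto intro!: integrable_mult_right int simp del: of_real_mult)
  also have "\<dots> = 0"
    using integral_sin_cos_power_eq_0[OF g zero, of 1] by simp
  finally show ?thesis .
qed

text \<open>The functions \<open>min 1 (max 0 (k (cos (\<pi> x) - cos (\<pi> t))))\<close> increase to the indicator of
  \<open>{..<t}\<close> on \<open>(0, 1)\<close> and are uniform limits of polynomials in \<open>cos (\<pi> x)\<close>.\<close>

lemma integral_sin_initial_segment_eq_0:
  assumes g: "square_integrable g"
    and zero: "\<And>n. n \<ge> 1 \<Longrightarrow> (\<integral>x. g x * complex_of_real (sin (real n * pi * x)) \<partial>unit_leb) = 0"
    and t: "t \<in> {0..1}"
  shows "(\<integral>x. indicat_real {..<t} x *\<^sub>R (g x * complex_of_real (sin (pi * x))) \<partial>unit_leb) = 0"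
proof -
  let ?gs = "\<lambda>x. g x * complex_of_real (sin (pi * x))"
  define c where "c = cos (pi * t)"
  define \<phi> where "\<phi> = (\<lambda>k::nat. \<lambda>y. min 1 (max 0 (real k * (y - c))))"
  \<comment> \<open>Tying the accuracy to \<open>k\<close> gives one sequence of polynomials in
    which steepening and approximation happen together.\<close>
  have "\<exists>q. real_polynomial_function q \<and> (\<forall>y\<in>{-1..1}. \<bar>\<phi> k y - q y\<bar> < 1 / real (Suc k))" for k
  proof -
    have "continuous_on {-1..1} (\<phi> k)"
      unfolding \<phi>_def by (intro continuous_intros)
    then show ?thesis
      using Stone_Weierstrass_real_polynomial_function[of "{-1..1::real}" "\<phi> k" "1 / real (Suc k)"]
      by (metis compact_Icc of_nat_0_less_iff zero_less_Suc zero_less_divide_1_iff)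
  qed
  then obtain q where q: "\<And>k. real_polynomial_function (q k)"
    and q_approx: "\<And>k y. y \<in> {-1..1} \<Longrightarrow> \<bar>\<phi> k y - q k y\<bar> < 1 / real (Suc k)"
    by metis
  have int: "integrable unit_leb ?gs"
    by (intro integrable_square_integrable_mult_continuous[OF g] continuous_intros)
  have q_cont: "continuous_on S (q k)" for k S
    using q[of k] by (simp add: continuous_on_polymonial_function real_polynomial_function_eq)
  have gq: "integrable unit_leb (\<lambda>x. g x * complex_of_real (sin (pi * x) * q k (cos (pi * x))))" for k
    by (intro integrable_square_integrable_mult_continuous[OF g] continuous_intros
         continuous_on_compose2[OF q_cont[of UNIV]]) auto
  have [measurable]: "indicat_real {..<t} \<in> borel_measurable unit_leb"
    by (intro measurable_restrict_space1 measurable_completion) measurable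
  have lim: "(\<lambda>k. q k (cos (pi * x))) \<longlonglongrightarrow> indicat_real {..<t} x" if x: "x \<in> {0<..<1}" for x
  proof -
    let ?y = "cos (pi * x)"
    \<comment> \<open>The cosine decreases on [0, pi], which reverses the order.\<close>
    have less_iff: "c < ?y \<longleftrightarrow> x < t"
      unfolding c_def using x t by (subst cos_mono_less_eq) (auto simp: mult_le_cancel_left1)
    have "(\<lambda>k. \<phi> k ?y) \<longlonglongrightarrow> indicat_real {..<t} x"
    proof (cases "x < t")
      case True
      obtain K where K: "1 / (?y - c) \<le> real K" using real_arch_simple by blast
      have "\<phi> k ?y = 1" if "k \<ge> K" for k
      proof -
        have "1 / (?y - c) \<le> real k" using K that by (meson of_nat_mono order_trans)
        then have "1 \<le> real k * (?y - c)" using True less_iff by (simp add: field_simps)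
        then show ?thesis by (simp add: \<phi>_def)
      qed
      then show ?thesis using True
        by (intro tendsto_eventually eventually_sequentiallyI[of K]) simp
    next
      case False
      then have "\<phi> k ?y = 0" for k
        using less_iff by (simp add: \<phi>_def mult_nonneg_nonpos)
      then show ?thesis using False by simp
    qed
    moreover have "(\<lambda>k. \<phi> k ?y - q k ?y) \<longlonglongrightarrow> 0"
    proof (rule tendsto_rabs_zero_cancel, rule tendsto_sandwich[of "\<lambda>_. 0" _ _ "\<lambda>k. 1 / real (Suc k)"])
      show "(\<lambda>k. 1 / real (Suc k)) \<longlonglongrightarrow> 0" using LIMSEQ_inverse_real_of_nat by (simp add: inverse_eq_divide)
    qed (use q_approx[of ?y] in \<open>auto intro!: always_eventually less_imp_le\<close>)
    ultimately have "(\<lambda>k. \<phi> k ?y - (\<phi> k ?y - q k ?y)) \<longlonglongrightarrow> indicat_real {..<t} x - 0"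
      by (rule tendsto_diff)
    then show ?thesis by simp
  qed
  have "(\<lambda>k. \<integral>x. g x * complex_of_real (sin (pi * x) * q k (cos (pi * x))) \<partial>unit_leb)
     \<longlonglongrightarrow> (\<integral>x. indicat_real {..<t} x *\<^sub>R ?gs x \<partial>unit_leb)"
  proof (rule integral_dominated_convergence)
    show "integrable unit_leb (\<lambda>x. 2 * norm (?gs x))"
      using int by (intro integrable_mult_right integrable_norm)
    show "(\<lambda>x. indicat_real {..<t} x *\<^sub>R ?gs x) \<in> borel_measurable unit_leb"
      by (intro borel_measurable_scaleR borel_measurable_integrable[OF int]) measurable
    show "(\<lambda>x. g x * complex_of_real (sin (pi * x) * q k (cos (pi * x)))) \<in> borel_measurable unit_leb" for k
      by (rule borel_measurable_integrable[OF gq])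
    show "AE x in unit_leb. (\<lambda>k. g x * complex_of_real (sin (pi * x) * q k (cos (pi * x))))
       \<longlonglongrightarrow> indicat_real {..<t} x *\<^sub>R ?gs x"
    proof (intro AE_I2)
      fix x assume "x \<in> space unit_leb"
      then have "(\<lambda>k. q k (cos (pi * x)) *\<^sub>R ?gs x) \<longlonglongrightarrow> indicat_real {..<t} x *\<^sub>R ?gs x"
        by (intro tendsto_intros lim) auto
      then show "(\<lambda>k. g x * complex_of_real (sin (pi * x) * q k (cos (pi * x))))
         \<longlonglongrightarrow> indicat_real {..<t} x *\<^sub>R ?gs x"
        by (simp add: scaleR_conv_of_real mult_ac)
    qed
    \<comment> \<open>The factor 2 bounds \<open>q k\<close>: \<open>\<phi> k\<close> is at most 1
      and the approximation error is at most 1.\<close>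
    show "AE x in unit_leb. norm (g x * complex_of_real (sin (pi * x) * q k (cos (pi * x)))) \<le> 2 * norm (?gs x)" for k
    proof (intro AE_I2)
      fix x :: real
      have "\<bar>q k (cos (pi * x))\<bar> \<le> \<bar>\<phi> k (cos (pi * x))\<bar> + 1 / real (Suc k)"
        using q_approx[of "cos (pi * x)" k] by simp
      also have "\<dots> \<le> 1 + 1" by (intro add_mono) (auto simp: \<phi>_def)
      finally have "norm (?gs x) * \<bar>q k (cos (pi * x))\<bar> \<le> norm (?gs x) * 2"
        by (intro mult_left_mono) auto
      then show "norm (g x * complex_of_real (sin (pi * x) * q k (cos (pi * x)))) \<le> 2 * norm (?gs x)"
        by (simp add: norm_mult mult_ac)
    qed
  qed
  moreover have "(\<integral>x. g x * complex_of_real (sin (pi * x) * q k (cos (pi * x))) \<partial>unit_leb) = 0" for k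
    by (rule integral_sin_polynomial_cos_eq_0[OF g zero q])
  ultimately show ?thesis by (simp add: LIMSEQ_const_iff)
qed

text \<open>Subtracting initial segments, all integrals over subintervals vanish. By Lebesgue
  differentiation almost every value is a limit of averages over such intervals, hence 0.\<close>

lemma AE_eq_0_if_integrals_initial_segment_eq_0:
  fixes f :: "real \<Rightarrow> complex"
  assumes int: "integrable unit_leb f"
    and zero: "\<And>t. t \<in> {0..1} \<Longrightarrow> (\<integral>x. indicat_real {..<t} x *\<^sub>R f x \<partial>unit_leb) = 0"
  shows "AE x in unit_leb. f x = 0"
proof -
  \<comment> \<open>Extension by zero to the whole line, where the differentiation theorem is
    stated.\<close>
  define G where "G = (\<lambda>x. indicat_real {0<..<1} x *\<^sub>R f x)"
  have G: "integrable lebesgue G"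
    using int by (simp add: integrable_restrict_space G_def)
  have G_on: "set_integrable lebesgue A G" if "A \<in> sets lebesgue" for A
    unfolding set_integrable_def by (rule integrable_mult_indicator[OF that G])
  have seg: "set_lebesgue_integral lebesgue {..<t} G = 0" if "t \<in> {0..1}" for t
  proof -
    have "set_lebesgue_integral lebesgue {..<t} G = (\<integral>x. indicat_real {..<t} x *\<^sub>R f x \<partial>unit_leb)"
      unfolding set_lebesgue_integral_def G_def
      by (subst integral_restrict_space) (auto simp: mult_ac)
    then show ?thesis using zero[OF that] by simp
  qed
  have ivl: "integral {a..b} G = 0" if ab: "0 \<le> a" "a \<le> b" "b \<le> 1" for a b
  proof -
    have "{..<b} = {..<a} \<union> {a..<b}" using ab by auto
    moreover have "set_lebesgue_integral lebesgue ({..<a} \<union> {a..<b}) G =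
        set_lebesgue_integral lebesgue {..<a} G + set_lebesgue_integral lebesgue {a..<b} G"
      by (intro set_integral_Un G_on) auto
    ultimately have "set_lebesgue_integral lebesgue {a..<b} G = 0"
      using seg[of a] seg[of b] ab by simp
    moreover have "set_lebesgue_integral lebesgue {a..<b} G = integral {a..<b} G"
      by (intro set_lebesgue_integral_eq_integral G_on) auto
    moreover have "integral {a..<b} G = integral {a..b} G"
      by (intro integral_spike_set) (auto intro: negligible_subset[of "{b}"])
    ultimately show ?thesis by simp
  qed
  have "G integrable_on cbox a b" for a b
    by (intro set_lebesgue_integral_eq_integral(1) G_on) auto
  then obtain N where N: "negligible N" and conv: "\<And>x e. \<lbrakk>x \<notin> N; 0 < e\<rbrakk> \<Longrightarrow> \<exists>d>0. \<forall>h. 0 < h \<and> h < d \<longrightarrow>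
     norm (integral (cbox x (x + h *\<^sub>R One)) G /\<^sub>R h ^ DIM(real) - G x) < e"
    using integrable_ccontinuous_explicit[of G] by metis
  have "f x = 0" if x: "x \<in> {0<..<1}" "x \<notin> N" for x
  proof (rule ccontr)
    assume "f x \<noteq> 0"
    then obtain d where d: "d > 0" "\<And>h. 0 < h \<and> h < d \<Longrightarrow>
        norm (integral (cbox x (x + h *\<^sub>R One)) G /\<^sub>R h ^ DIM(real) - G x) < norm (f x)"
      using conv[of x "norm (f x)"] x by auto
    \<comment> \<open>This \<open>h\<close> lies below \<open>d\<close> and keeps
      \<open>[x, x + h]\<close> inside the unit interval. The average over it is 0, so its distance
      to \<open>f x\<close> is \<open>norm (f x)\<close>, contradicting the strict bound.\<close>
    define h where "h = min (d / 2) (1 - x)"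
    have h: "0 < h" "h < d" "x + h \<le> 1" using x d by (auto simp: h_def)
    then have "integral (cbox x (x + h *\<^sub>R One)) G = 0" using ivl[of x "x + h"] x by simp
    then show False using d(2)[of h] h x by (simp add: G_def)
  qed
  then have "{x \<in> space unit_leb. f x \<noteq> 0} \<subseteq> N" by auto
  moreover have "AE x in lebesgue. x \<notin> N"
    using N by (intro AE_not_in) (simp add: negligible_iff_null_sets)
  ultimately have "AE x in lebesgue. x \<in> {0<..<1} \<longrightarrow> f x = 0" by (auto elim!: eventually_mono)
  then show ?thesis by (subst AE_restrict_space_iff) auto
qed

lemma AE_eq_0_if_sine_integrals_eq_0:
  assumes g: "square_integrable g"
    and zero: "\<And>n. n \<ge> 1 \<Longrightarrow> (\<integral>x. g x * complex_of_real (sin (real n * pi * x)) \<partial>unit_leb) = 0"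
  shows "AE x in unit_leb. g x = 0"
proof -
  have "AE x in unit_leb. g x * complex_of_real (sin (pi * x)) = 0"
    by (intro AE_eq_0_if_integrals_initial_segment_eq_0 integral_sin_initial_segment_eq_0
        integrable_square_integrable_mult_continuous[OF g] g zero continuous_intros)
  moreover have "AE x in unit_leb. sin (pi * x) \<noteq> 0"
    using sin_gt_zero[of "pi * _"] by (intro AE_I2) force
  ultimately show ?thesis by eventually_elim auto
qed

section \<open>The Riesz--Fischer theorem for sine series\<close>

text \<open>Integer frequencies are used because the product formula for sines produces differences,
  possibly negative.\<close>

lemma integral_cos_unit_leb:
  fixes k :: int
  shows "(\<integral>x. cos (of_int k * pi * x) \<partial>unit_leb) = (if k = 0 then 1 else 0)"
proof -
  have int: "integrable unit_leb (\<lambda>x. cos (of_int k * pi * x))"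
    by (intro integrable_unit_leb_continuous continuous_intros)
  have "((\<lambda>x. cos (of_int k * pi * x)) has_integral (if k = 0 then 1 else 0)) {0..1}"
  proof (cases "k = 0")
    case True
    then show ?thesis using has_integral_const_real[of "1::real" 0 1] by simp
  next
    case False
    have "((\<lambda>x. cos (of_int k * pi * x)) has_integral
        (sin (of_int k * pi * 1) / (of_int k * pi) - sin (of_int k * pi * 0) / (of_int k * pi))) {0..1}"
      using False by (intro fundamental_theorem_of_calculus)
        (auto intro!: derivative_eq_intros simp: has_real_derivative_iff_has_vector_derivative[symmetric])
    moreover have "sin (of_int k * pi) = (0::real)"
      using sin_times_pi_eq_0[of "of_int k"] by simp
    ultimately show ?thesis using False by simp
  qed
  then have "((\<lambda>x. cos (of_int k * pi * x)) has_integral (if k = 0 then 1 else 0)) {0<..<1}"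
    by (simp add: has_integral_Icc_iff_Ioo)
  then show ?thesis
    using lebesgue_integral_eq_integral[OF int] by (simp add: integral_unique)
qed

lemma integral_sin_mult_sin:
  assumes "m \<ge> 1"
  shows "(\<integral>x. sin (real n * pi * x) * sin (real m * pi * x) \<partial>unit_leb) = (if n = m then 1 / 2 else 0)"
proof -
  have int: "integrable unit_leb (\<lambda>x. cos (of_int k * pi * x) / 2)" for k :: int
    by (intro integrable_unit_leb_continuous continuous_intros) auto
  have "(\<integral>x. sin (real n * pi * x) * sin (real m * pi * x) \<partial>unit_leb) =
     (\<integral>x. cos (of_int (int n - int m) * pi * x) / 2 - cos (of_int (int n + int m) * pi * x) / 2 \<partial>unit_leb)"
  proof (intro Bochner_Integration.integral_cong refl)
    fix x
    have "of_int (int n - int m) * pi * x = real n * pi * x - real m * pi * x"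
      "of_int (int n + int m) * pi * x = real n * pi * x + real m * pi * x"
      by (simp_all add: algebra_simps)
    then show "sin (real n * pi * x) * sin (real m * pi * x) =
        cos (of_int (int n - int m) * pi * x) / 2 - cos (of_int (int n + int m) * pi * x) / 2"
      by (simp only: sin_times_sin diff_divide_distrib)
  qed
  also have "\<dots> = (if int n - int m = 0 then 1 else 0) / 2 - (if int n + int m = 0 then 1 else 0) / 2"
    by (subst Bochner_Integration.integral_diff[OF int int])
      (simp only: integral_divide_zero integral_cos_unit_leb)
  \<comment> \<open>The sum \<open>n + m\<close> cannot be 0 since \<open>m \<ge> 1\<close>, so only
    the difference frequency can contribute.\<close>
  also have "\<dots> = (if n = m then 1 / 2 else 0)"
    using assms by auto
  finally show ?thesis .
qed

definition sine_sum :: "nat set \<Rightarrow> (nat \<Rightarrow> complex) \<Rightarrow> real \<Rightarrow> complex" where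
  "sine_sum A c x = (\<Sum>n\<in>A. c n * complex_of_real (sqrt 2 * sin (real n * pi * x)))"

lemma continuous_on_sine_sum [continuous_intros]: "continuous_on S (sine_sum A c)"
  unfolding sine_sum_def by (intro continuous_intros)

lemma integral_sine_sum_mult_sin:
  assumes "finite A" "m \<ge> 1"
  shows "(\<integral>x. sine_sum A c x * complex_of_real (sqrt 2 * sin (real m * pi * x)) \<partial>unit_leb) =
    (if m \<in> A then c m else 0)"
proof -
  have "(\<integral>x. sine_sum A c x * complex_of_real (sqrt 2 * sin (real m * pi * x)) \<partial>unit_leb) =
     (\<integral>x. (\<Sum>n\<in>A. c n * complex_of_real (2 * (sin (real n * pi * x) * sin (real m * pi * x)))) \<partial>unit_leb)"
  proof (intro Bochner_Integration.integral_cong refl)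
    fix x
    have *: "sqrt 2 * a * (sqrt 2 * b) = 2 * (a * b)" for a b :: real
      by (simp add: mult.assoc mult.left_commute[of a])
    show "sine_sum A c x * complex_of_real (sqrt 2 * sin (real m * pi * x)) =
        (\<Sum>n\<in>A. c n * complex_of_real (2 * (sin (real n * pi * x) * sin (real m * pi * x))))"
      unfolding sine_sum_def sum_distrib_right mult.assoc[of "c _"] of_real_mult[symmetric] * ..
  qed
  also have "\<dots> = (\<Sum>n\<in>A. \<integral>x. c n * complex_of_real (2 * (sin (real n * pi * x) * sin (real m * pi * x))) \<partial>unit_leb)"
    by (intro Bochner_Integration.integral_sum integrable_unit_leb_continuous continuous_intros)
  also have "\<dots> = (\<Sum>n\<in>A. if n = m then c n else 0)"
    using assms(2) by (intro sum.cong refl)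
      (simp only: integral_mult_right_zero integral_complex_of_real integral_sin_mult_sin, simp)
  finally show ?thesis using assms by simp
qed

text \<open>Expanding only the conjugate factor of the squared modulus reduces the integral to
  coefficients already computed.\<close>

lemma integral_norm_sine_sum:
  assumes A: "finite A" "A \<subseteq> {1..}"
  shows "(\<integral>x. (cmod (sine_sum A c x))\<^sup>2 \<partial>unit_leb) = (\<Sum>n\<in>A. (cmod (c n))\<^sup>2)"
proof -
  have "complex_of_real (\<integral>x. (cmod (sine_sum A c x))\<^sup>2 \<partial>unit_leb) =
     (\<integral>x. (\<Sum>m\<in>A. cnj (c m) * (sine_sum A c x * complex_of_real (sqrt 2 * sin (real m * pi * x)))) \<partial>unit_leb)"
    unfolding integral_complex_of_real[symmetric]
  proof (intro Bochner_Integration.integral_cong refl)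
    fix x
    have "cnj (sine_sum A c x) = (\<Sum>m\<in>A. cnj (c m) * complex_of_real (sqrt 2 * sin (real m * pi * x)))"
      by (simp add: sine_sum_def)
    then show "complex_of_real ((cmod (sine_sum A c x))\<^sup>2) =
        (\<Sum>m\<in>A. cnj (c m) * (sine_sum A c x * complex_of_real (sqrt 2 * sin (real m * pi * x))))"
      by (simp only: complex_norm_square sum_distrib_left) (simp add: mult_ac)
  qed
  also have "\<dots> = (\<Sum>m\<in>A. \<integral>x. cnj (c m) * (sine_sum A c x * complex_of_real (sqrt 2 * sin (real m * pi * x))) \<partial>unit_leb)"
    by (intro Bochner_Integration.integral_sum integrable_unit_leb_continuous continuous_intros)
  also have "\<dots> = (\<Sum>m\<in>A. cnj (c m) * c m)"
    using A by (intro sum.cong refl) (auto simp: integral_sine_sum_mult_sin simp del: of_real_mult)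
  also have "\<dots> = complex_of_real (\<Sum>n\<in>A. (cmod (c n))\<^sup>2)"
    by (simp only: of_real_sum complex_norm_square mult.commute)
  finally show ?thesis by (simp only: of_real_eq_iff)
qed

text \<open>A subsequence of the partial sums with increments of norm \<open>2 ^ -k\<close> converges almost
  everywhere and in \<open>L\<^sup>1\<close>; Fatou's lemma puts its limit into \<open>L\<^sup>2\<close>.\<close>

theorem riesz_fischer_sine:
  assumes bound: "\<And>N. (\<Sum>n=1..N. (cmod (c n))\<^sup>2) \<le> K"
  shows "\<exists>f. square_integrable f \<and> (\<forall>m\<ge>1.
     (\<integral>x. f x * complex_of_real (sqrt 2 * sin (real m * pi * x)) \<partial>unit_leb) = c m)"
proof -
  define s where "s = (\<lambda>N. \<Sum>n=1..N. (cmod (c n))\<^sup>2)"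
  have "incseq s" unfolding s_def by (intro incseq_SucI) simp
  then have "Cauchy s"
    using bound by (intro LIMSEQ_imp_Cauchy[OF LIMSEQ_incseq_SUP])
      (auto simp: s_def bdd_above_def)
  \<comment> \<open>The partial sums \<open>s\<close> measure squared norms, so
    \<open>(1 / 4) ^ k\<close> here means norm \<open>(1 / 2) ^ k\<close>.\<close>
  have "\<exists>M. \<forall>m\<ge>M. \<forall>n\<ge>M. norm (s m - s n) < (1 / 4) ^ k" for k
    by (rule CauchyD[OF \<open>Cauchy s\<close>]) simp
  then obtain M where M: "\<And>k m n. m \<ge> M k \<Longrightarrow> n \<ge> M k \<Longrightarrow> norm (s m - s n) < (1 / 4) ^ k"
    by metis
  \<comment> \<open>Cumulative sums make \<open>r\<close> strictly increasing and keep
    \<open>r k\<close> above \<open>M k\<close>.\<close>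
  define r where "r = (\<lambda>k. \<Sum>i\<le>k. Suc (M i))"
  have r_Suc: "r k < r (Suc k)" for k by (simp add: r_def)
  have r_M: "M k \<le> r k" for k by (cases k) (auto simp: r_def)
  have "filterlim r at_top sequentially"
    using r_Suc by (intro filterlim_subseq) (simp add: strict_mono_Suc_iff)
  define f where "f = (\<lambda>k. sine_sum {1..r k} c)"
  define g where "g = (\<lambda>k. sine_sum {r k<..r (Suc k)} c)"
  have g_diff: "g k x = f (Suc k) x - f k x" for k x
  proof -
    have "{1..r (Suc k)} = {1..r k} \<union> {r k<..r (Suc k)}" using r_Suc[of k] by auto
    then have "f (Suc k) x = f k x + g k x"
      unfolding f_def g_def sine_sum_def by (simp only:) (subst sum.union_disjoint, auto)
    then show ?thesis by simp
  qed
  have int_g: "integrable unit_leb (g k)" for k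
    unfolding g_def by (intro integrable_unit_leb_continuous continuous_intros)
  have norm_g: "(\<integral>x. norm (g k x) \<partial>unit_leb) \<le> (1 / 2) ^ k" for k
  proof -
    let ?q = "(1 / 2 :: real) ^ k"
    have "{1..r (Suc k)} = {1..r k} \<union> {r k<..r (Suc k)}" using r_Suc[of k] by auto
    then have "s (r (Suc k)) = s (r k) + (\<Sum>n\<in>{r k<..r (Suc k)}. (cmod (c n))\<^sup>2)"
      unfolding s_def by (simp only:) (subst sum.union_disjoint, auto)
    then have "(\<integral>x. (cmod (g k x))\<^sup>2 \<partial>unit_leb) = s (r (Suc k)) - s (r k)"
      unfolding g_def by (subst integral_norm_sine_sum) auto
    also have "\<dots> \<le> (1 / 4) ^ k"
      using M[of k "r (Suc k)" "r k"] r_M[of k] r_Suc[of k] by force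
    also have "\<dots> = ?q\<^sup>2" by (simp add: power_mult[symmetric] mult.commute power2_eq_square flip: power_mult_distrib)
    finally have sq: "(\<integral>x. (cmod (g k x))\<^sup>2 \<partial>unit_leb) \<le> ?q\<^sup>2" .
    have int_sq: "integrable unit_leb (\<lambda>x. (cmod (g k x))\<^sup>2)"
      unfolding g_def by (intro integrable_unit_leb_continuous continuous_intros)
    \<comment> \<open>The arithmetic-geometric mean inequality with parameter \<open>?q\<close>
      passes from the square norm to the integral of the norm, and this parameter makes both halves
      at most \<open>?q / 2\<close>.\<close>
    have "(\<integral>x. norm (g k x) \<partial>unit_leb) \<le> (\<integral>x. ?q / 2 + (cmod (g k x))\<^sup>2 / (2 * ?q) \<partial>unit_leb)"
    proof (intro integral_mono integrable_norm int_g)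
      show "integrable unit_leb (\<lambda>x. ?q / 2 + (cmod (g k x))\<^sup>2 / (2 * ?q))"
        by (intro Bochner_Integration.integrable_add integrable_divide_zero int_sq
            integrable_unit_leb_continuous[OF continuous_on_const])
      fix x
      show "norm (g k x) \<le> ?q / 2 + (cmod (g k x))\<^sup>2 / (2 * ?q)"
        using sum_squares_bound[of "norm (g k x)" ?q] by (simp add: field_simps power2_eq_square)
    qed
    also have "\<dots> = ?q / 2 + (\<integral>x. (cmod (g k x))\<^sup>2 \<partial>unit_leb) / (2 * ?q)"
      by (subst Bochner_Integration.integral_add)
        (auto intro!: integrable_divide_zero int_sq integrable_unit_leb_continuous[OF continuous_on_const] simp: measure_restrict_space)
    also have "\<dots> \<le> ?q / 2 + ?q\<^sup>2 / (2 * ?q)"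
      by (intro add_left_mono divide_right_mono sq) simp
    also have "\<dots> = ?q" by (simp add: power2_eq_square)
    finally show ?thesis .
  qed
  have summ_norm_g: "summable (\<lambda>k. \<integral>x. norm (g k x) \<partial>unit_leb)"
    by (rule summable_comparison_test'[of "\<lambda>k. (1 / 2) ^ k"]) (auto simp: norm_g)
  have AE_summ: "AE x in unit_leb. summable (\<lambda>k. norm (g k x))"
  proof -
    have [measurable]: "g k \<in> borel_measurable unit_leb" for k
      by (rule borel_measurable_integrable[OF int_g])
    have "(\<integral>\<^sup>+x. (\<Sum>k. ennreal (norm (g k x))) \<partial>unit_leb) = (\<Sum>k. \<integral>\<^sup>+x. ennreal (norm (g k x)) \<partial>unit_leb)"
      by (rule nn_integral_suminf) measurable
    also have "\<dots> = (\<Sum>k. ennreal (\<integral>x. norm (g k x) \<partial>unit_leb))"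
      by (intro arg_cong[where f=suminf] ext nn_integral_eq_integral integrable_norm int_g) auto
    also have "\<dots> \<noteq> \<infinity>"
      unfolding infinity_ennreal_def by (rule ennreal_suminf_neq_top[OF summ_norm_g]) simp
    finally have "AE x in unit_leb. (\<Sum>k. ennreal (norm (g k x))) \<noteq> \<infinity>"
      by (intro nn_integral_PInf_AE) measurable
    then show ?thesis
      by eventually_elim (auto intro: summable_suminf_not_top)
  qed
  define F where "F = (\<lambda>x. f 0 x + (\<Sum>k. g k x))"
  have f_lim: "AE x in unit_leb. (\<lambda>k. f k x) \<longlonglongrightarrow> F x"
    using AE_summ
  proof eventually_elim
    case (elim x)
    then have "(\<lambda>n. f 0 x + (\<Sum>k<n. g k x)) \<longlonglongrightarrow> F x"
      unfolding F_def by (intro tendsto_add[OF tendsto_const] summable_LIMSEQ) (rule summable_norm_cancel)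
    moreover have "f 0 x + (\<Sum>k<n. g k x) = f n x" for n
      using sum_lessThan_telescope[of "\<lambda>k. f k x" n] by (simp add: g_diff)
    ultimately show ?case by simp
  qed
  have int_f0: "integrable unit_leb (f 0)"
    unfolding f_def by (intro integrable_unit_leb_continuous continuous_intros)
  have int_F: "integrable unit_leb F"
    unfolding F_def
    by (intro Bochner_Integration.integrable_add integrable_suminf int_g int_f0 AE_summ summ_norm_g)
  have F: "square_integrable F"
    unfolding square_integrable_def
  proof
    show [measurable]: "F \<in> borel_measurable unit_leb"
      by (rule borel_measurable_integrable[OF int_F])
    have "(\<integral>\<^sup>+x. ennreal ((cmod (F x))\<^sup>2) \<partial>unit_leb) \<le>
        (\<integral>\<^sup>+x. liminf (\<lambda>k. ennreal ((cmod (f k x))\<^sup>2)) \<partial>unit_leb)"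
      using f_lim
    proof (intro nn_integral_mono_AE, eventually_elim)
      case (elim x)
      then have "(\<lambda>k. ennreal ((cmod (f k x))\<^sup>2)) \<longlonglongrightarrow> ennreal ((cmod (F x))\<^sup>2)"
        by (intro tendsto_ennrealI tendsto_power tendsto_norm)
      then show ?case by (intro eq_refl lim_imp_Liminf[symmetric]) simp_all
    qed
    also have "\<dots> \<le> liminf (\<lambda>k. \<integral>\<^sup>+x. ennreal ((cmod (f k x))\<^sup>2) \<partial>unit_leb)"
      by (rule nn_integral_liminf)
        (auto simp: f_def intro!: measurable_compose[OF _ measurable_ennreal] measurable_unit_leb_continuous continuous_intros)
    also have "\<dots> \<le> ennreal K"
    proof (intro Liminf_le always_eventually allI)
      fix k
      have "(\<integral>\<^sup>+x. ennreal ((cmod (f k x))\<^sup>2) \<partial>unit_leb) = ennreal (\<integral>x. (cmod (f k x))\<^sup>2 \<partial>unit_leb)"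
        unfolding f_def by (intro nn_integral_eq_integral integrable_unit_leb_continuous continuous_intros) auto
      also have "(\<integral>x. (cmod (f k x))\<^sup>2 \<partial>unit_leb) = s (r k)"
        unfolding f_def s_def by (subst integral_norm_sine_sum) auto
      finally show "(\<integral>\<^sup>+x. ennreal ((cmod (f k x))\<^sup>2) \<partial>unit_leb) \<le> ennreal K"
        using bound[of "r k"] by (simp add: s_def ennreal_leI)
    qed simp
    finally show "integrable unit_leb (\<lambda>x. (cmod (F x))\<^sup>2)"
      by (intro integrableI_bounded) (auto simp: le_less_trans)
  qed
  moreover have "(\<integral>x. F x * complex_of_real (sqrt 2 * sin (real m * pi * x)) \<partial>unit_leb) = c m" if m: "m \<ge> 1" for m
  proof -
    let ?e = "\<lambda>x. complex_of_real (sqrt 2 * sin (real m * pi * x))"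
    \<comment> \<open>Boundedness of the sine transfers the summability of the norms of
      \<open>g k\<close> to the products, which justifies integrating termwise.\<close>
    have e_le: "cmod (?e x) \<le> sqrt 2" for x
      by (simp add: norm_mult mult_left_le)
    have int: "integrable unit_leb (\<lambda>x. f k x * ?e x)" "integrable unit_leb (\<lambda>x. g k x * ?e x)" for k
      unfolding f_def g_def by (intro integrable_unit_leb_continuous continuous_intros)+
    have AE_summ': "AE x in unit_leb. summable (\<lambda>k. norm (g k x * ?e x))"
      using AE_summ
      by eventually_elim (simp add: norm_mult summable_mult2)
    have summ': "summable (\<lambda>k. \<integral>x. norm (g k x * ?e x) \<partial>unit_leb)"
    proof (rule summable_comparison_test')
      show "summable (\<lambda>k. (\<integral>x. norm (g k x) \<partial>unit_leb) * sqrt 2)"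
        by (intro summable_mult2 summ_norm_g)
      fix k
      have "(\<integral>x. norm (g k x * ?e x) \<partial>unit_leb) \<le> (\<integral>x. norm (g k x) * sqrt 2 \<partial>unit_leb)"
        by (intro integral_mono integrable_norm int integrable_mult_left int_g)
          (simp only: norm_mult[of "g k _"], intro mult_left_mono e_le norm_ge_zero)
      then show "norm (\<integral>x. norm (g k x * ?e x) \<partial>unit_leb) \<le> (\<integral>x. norm (g k x) \<partial>unit_leb) * sqrt 2"
        by (simp del: of_real_mult)
    qed
    let ?I = "\<lambda>k. \<integral>x. f k x * ?e x \<partial>unit_leb"
    have "(\<integral>x. F x * ?e x \<partial>unit_leb) = (\<integral>x. f 0 x * ?e x + (\<Sum>k. g k x * ?e x) \<partial>unit_leb)"
    proof (rule integral_cong_AE)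
      show "(\<lambda>x. F x * ?e x) \<in> borel_measurable unit_leb"
        by (intro borel_measurable_integrable integrable_square_integrable_mult_continuous F continuous_intros)
      show "(\<lambda>x. f 0 x * ?e x + (\<Sum>k. g k x * ?e x)) \<in> borel_measurable unit_leb"
        by (intro borel_measurable_integrable Bochner_Integration.integrable_add integrable_suminf int AE_summ' summ')
      show "AE x in unit_leb. F x * ?e x = f 0 x * ?e x + (\<Sum>k. g k x * ?e x)"
        using AE_summ
      proof eventually_elim
        case (elim x)
        then have "summable (\<lambda>k. g k x)" by (rule summable_norm_cancel)
        then show ?case by (simp add: F_def distrib_right suminf_mult2 del: of_real_mult)
      qed
    qed
    also have "\<dots> = ?I 0 + (\<Sum>k. \<integral>x. g k x * ?e x \<partial>unit_leb)"
      by (subst Bochner_Integration.integral_add)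
        (auto intro!: integrable_suminf integral_suminf int AE_summ' summ' simp del: of_real_mult)
    also have "(\<lambda>k. \<integral>x. g k x * ?e x \<partial>unit_leb) = (\<lambda>k. ?I (Suc k) - ?I k)"
    proof
      fix k
      show "(\<integral>x. g k x * ?e x \<partial>unit_leb) = ?I (Suc k) - ?I k"
        unfolding g_diff left_diff_distrib by (intro Bochner_Integration.integral_diff int)
    qed
    \<comment> \<open>By orthogonality \<open>?I k\<close> equals \<open>c m\<close> once
      \<open>r k \<ge> m\<close>, so the telescoping series stabilizes.\<close>
    also have "(\<Sum>k. ?I (Suc k) - ?I k) = c m - ?I 0"
    proof (intro sums_unique[symmetric] telescope_sums tendsto_eventually)
      have "eventually (\<lambda>k. m \<le> r k) sequentially"
        using \<open>filterlim r at_top sequentially\<close> by (simp add: filterlim_at_top)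
      then show "eventually (\<lambda>k. ?I k = c m) sequentially"
        unfolding f_def by eventually_elim (use m in \<open>simp add: integral_sine_sum_mult_sin del: of_real_mult\<close>)
    qed
    finally show ?thesis by simp
  qed
  ultimately show ?thesis by blast
qed

section \<open>Riesz bases in sine coordinates\<close>

lemma sine_coeff_abs_l2:
  assumes "square_integrable f"
  shows "sine_coeff (abs_l2 f) n =
    (\<integral>x. f x * complex_of_real (sqrt 2 * sin (real n * pi * x)) \<partial>unit_leb)"
proof -
  have "L2_eq f f" using assms by (simp add: L2_eq_def)
  then have "sine_coeff (abs_l2 f) n =
      complex_of_real (sqrt 2) * (\<integral>x. f x * complex_of_real (sin (real n * pi * x)) \<partial>unit_leb)"
    by (simp add: sine_coeff.abs_eq)
  then show ?thesis
    by (simp add: mult.left_commute[of _ "complex_of_real (sqrt 2)"])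
qed

lemma integrable_mult_sin:
  "square_integrable f \<Longrightarrow> integrable unit_leb (\<lambda>x. f x * complex_of_real (sin (real n * pi * x)))"
  by (intro integrable_square_integrable_mult_continuous continuous_intros)

lemma sine_coeff_add: "sine_coeff (f + g) n = sine_coeff f n + sine_coeff g n"
  by transfer (simp add: L2_eq_def integrable_mult_sin distrib_left distrib_right)

lemma sine_coeff_scale: "sine_coeff (scale_l2 c f) n = c * sine_coeff f n"
  by transfer (simp add: mult.assoc mult.left_commute)

text \<open>Completeness of the sines, applied to the difference of two representatives.\<close>

lemma sine_coeff_inject:
  assumes "\<And>n. n \<ge> 1 \<Longrightarrow> sine_coeff f n = sine_coeff g n"
  shows "f = g"
  using assms
proof transfer
  fix f g :: "real \<Rightarrow> complex"
  assume "L2_eq f f" "L2_eq g g"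
  then have f: "square_integrable f" and g: "square_integrable g" by (auto simp: L2_eq_def)
  let ?d = "\<lambda>x. f x + (-1) * g x"
  assume eq: "\<And>n. 1 \<le> n \<Longrightarrow>
      complex_of_real (sqrt 2) * (\<integral>x. f x * complex_of_real (sin (real n * pi * x)) \<partial>unit_leb) =
      complex_of_real (sqrt 2) * (\<integral>x. g x * complex_of_real (sin (real n * pi * x)) \<partial>unit_leb)"
  have "AE x in unit_leb. ?d x = 0"
  proof (rule AE_eq_0_if_sine_integrals_eq_0)
    show "square_integrable ?d"
      by (intro square_integrable_add square_integrable_scale f g)
    show "(\<integral>x. ?d x * complex_of_real (sin (real n * pi * x)) \<partial>unit_leb) = 0" if "n \<ge> 1" for n
      using eq[OF that] f g by (simp add: left_diff_distrib integrable_mult_sin)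
  qed
  then have "AE x in unit_leb. f x = g x" by eventually_elim simp
  then show "L2_eq f g" using f g by (simp add: L2_eq_def)
qed

text \<open>These are the coefficients of \<open>f\<close> in \<open>H \<alpha>\<close> with respect
  to the normalized sines. They turn \<open>H_inner \<alpha>\<close> into the standard inner product
  of sequences.\<close>

definition wcoeff :: "real \<Rightarrow> l2 \<Rightarrow> nat \<Rightarrow> complex" where
  "wcoeff \<alpha> f n = complex_of_real (real n powr \<alpha>) * sine_coeff f n"

lemma wcoeff_0 [simp]: "wcoeff \<alpha> f 0 = 0"
  by (simp add: wcoeff_def)

lemma wcoeff_add: "wcoeff \<alpha> (f + g) = (\<lambda>n. wcoeff \<alpha> f n + wcoeff \<alpha> g n)"
  by (simp add: fun_eq_iff wcoeff_def sine_coeff_add distrib_left)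

lemma wcoeff_scale: "wcoeff \<alpha> (scale_l2 c f) = (\<lambda>n. c * wcoeff \<alpha> f n)"
  by (simp add: fun_eq_iff wcoeff_def sine_coeff_scale)

lemma wcoeff_diff: "wcoeff \<alpha> (f - g) n = wcoeff \<alpha> f n - wcoeff \<alpha> g n"
  using wcoeff_add[of \<alpha> "f - g" g] by simp

lemma wcoeff_sum: "wcoeff \<alpha> (\<Sum>i\<in>I. f i) n = (\<Sum>i\<in>I. wcoeff \<alpha> (f i) n)"
proof (induction I rule: infinite_finite_induct)
  case (insert i I)
  then show ?case by (simp add: wcoeff_add)
qed (use wcoeff_diff[of \<alpha> 0 0] in simp_all)

lemma wcoeff_inject:
  assumes "wcoeff \<alpha> f = wcoeff \<alpha> g"
  shows "f = g"
proof (rule sine_coeff_inject)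
  fix n :: nat assume "n \<ge> 1"
  then show "sine_coeff f n = sine_coeff g n"
    using fun_cong[OF assms, of n] by (simp add: wcoeff_def)
qed

lemma powr_double: "real n powr (2 * \<alpha>) = real n powr \<alpha> * real n powr \<alpha>"
  by (simp add: powr_add[symmetric])

lemma H_inner_eq: "H_inner \<alpha> f g = (\<Sum>\<^sub>\<infinity>n\<in>{1..}. wcoeff \<alpha> f n * cnj (wcoeff \<alpha> g n))"
  unfolding H_inner_def wcoeff_def powr_double by (simp add: mult_ac)

lemma mem_H_iff_summable: "f \<in> H \<alpha> \<longleftrightarrow> (\<lambda>n. (cmod (wcoeff \<alpha> f n))\<^sup>2) summable_on {1..}"
  unfolding H_def wcoeff_def powr_double by (simp add: norm_mult power2_eq_square mult_ac)

lemma ip_norm_H: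
  assumes "f \<in> H \<alpha>"
  shows "ip_norm (H_inner \<alpha>) f = sqrt (\<Sum>\<^sub>\<infinity>n\<in>{1..}. (cmod (wcoeff \<alpha> f n))\<^sup>2)"
proof -
  have "H_inner \<alpha> f f = (\<Sum>\<^sub>\<infinity>n\<in>{1..}. complex_of_real ((cmod (wcoeff \<alpha> f n))\<^sup>2))"
    by (simp only: H_inner_eq complex_norm_square)
  also have "\<dots> = complex_of_real (\<Sum>\<^sub>\<infinity>n\<in>{1..}. (cmod (wcoeff \<alpha> f n))\<^sup>2)"
    using assms unfolding mem_H_iff_summable
    by (intro infsumI has_sum_of_real_iff[THEN iffD2] has_sum_infsum)
  finally show ?thesis by (simp add: ip_norm_def)
qed

lemma trunc_norm_le_ip_norm:
  assumes "f \<in> H \<alpha>"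
  shows "trunc_norm N (wcoeff \<alpha> f) \<le> ip_norm (H_inner \<alpha>) f"
  using assms unfolding trunc_norm_def L2_set_def ip_norm_H[OF assms] mem_H_iff_summable
  by (intro real_sqrt_le_mono finite_sum_le_infsum) auto

text \<open>Every finite set of positive integers lies in some \<open>{1..N}\<close>, so bounds
  uniform in \<open>N\<close> control all finite subsums. This is how truncated estimates become
  statements about \<open>H \<alpha>\<close>.\<close>

lemma
  assumes bound: "\<And>N. trunc_norm N (wcoeff \<alpha> f) \<le> K"
  shows mem_HI: "f \<in> H \<alpha>"
    and ip_norm_H_le: "ip_norm (H_inner \<alpha>) f \<le> K"
proof -
  have K: "0 \<le> K" using order_trans[OF trunc_norm_nonneg bound] .
  have le: "(\<Sum>n\<in>F. (cmod (wcoeff \<alpha> f n))\<^sup>2) \<le> K\<^sup>2" if F: "finite F" "F \<subseteq> {1..}" for F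
  proof -
    have "(\<Sum>n\<in>F. (cmod (wcoeff \<alpha> f n))\<^sup>2) \<le> (\<Sum>n=1..Max (insert 0 F). (cmod (wcoeff \<alpha> f n))\<^sup>2)"
      using F by (intro sum_mono2) auto
    also have "\<dots> = (trunc_norm (Max (insert 0 F)) (wcoeff \<alpha> f))\<^sup>2"
      by (simp add: trunc_norm_def L2_set_def sum_nonneg)
    also have "\<dots> \<le> K\<^sup>2" by (intro power_mono bound trunc_norm_nonneg)
    finally show ?thesis .
  qed
  have summable: "(\<lambda>n. (cmod (wcoeff \<alpha> f n))\<^sup>2) summable_on {1..}"
    using le by (intro nonneg_bdd_above_summable_on) (auto simp: bdd_above_def)
  then show f: "f \<in> H \<alpha>" by (simp add: mem_H_iff_summable)
  have "(\<Sum>\<^sub>\<infinity>n\<in>{1..}. (cmod (wcoeff \<alpha> f n))\<^sup>2) \<le> K\<^sup>2"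
    by (rule infsum_le_finite_sums[OF summable]) (rule le)
  then show "ip_norm (H_inner \<alpha>) f \<le> K"
    using K by (simp add: ip_norm_H[OF f] real_le_lsqrt infsum_nonneg)
qed

text \<open>Riesz-Fischer for the unweighted coefficients. As \<open>\<alpha> \<ge> 0\<close>,
  dividing by \<open>real n powr \<alpha>\<close> only decreases them.\<close>

lemma ex_wcoeff:
  assumes \<alpha>: "\<alpha> \<ge> 0" and b0: "b 0 = 0" and bound: "\<And>N. trunc_norm N b \<le> K"
  shows "\<exists>f\<in>H \<alpha>. wcoeff \<alpha> f = b"
proof -
  let ?c = "\<lambda>n. b n / complex_of_real (real n powr \<alpha>)"
  have "(\<Sum>n=1..N. (cmod (?c n))\<^sup>2) \<le> K\<^sup>2" for N
  proof -
    have "(\<Sum>n=1..N. (cmod (?c n))\<^sup>2) \<le> (\<Sum>n=1..N. (cmod (b n))\<^sup>2)"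
    proof (intro sum_mono power_mono)
      fix n assume n: "n \<in> {1..N}"
      then have "1 \<le> real n powr \<alpha>" using \<alpha> by (intro ge_one_powr_ge_zero) auto
      then have "cmod (b n) / real n powr \<alpha> \<le> cmod (b n) / 1"
        using n by (intro divide_left_mono) auto
      then show "cmod (?c n) \<le> cmod (b n)" by (simp add: norm_divide)
    qed simp
    also have "\<dots> = (trunc_norm N b)\<^sup>2"
      by (simp add: trunc_norm_def L2_set_def sum_nonneg)
    also have "\<dots> \<le> K\<^sup>2" by (intro power_mono bound trunc_norm_nonneg)
    finally show ?thesis .
  qed
  then obtain g where g: "square_integrable g" "\<And>m. m \<ge> 1 \<Longrightarrow>
     (\<integral>x. g x * complex_of_real (sqrt 2 * sin (real m * pi * x)) \<partial>unit_leb) = ?c m"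
    using riesz_fischer_sine[of ?c "K\<^sup>2"] by auto
  have "wcoeff \<alpha> (abs_l2 g) m = b m" for m
    using g(2)[of m] b0 by (cases "m = 0") (auto simp: wcoeff_def sine_coeff_abs_l2[OF g(1)] simp del: of_real_mult)
  then have eq: "wcoeff \<alpha> (abs_l2 g) = b" by blast
  then have "abs_l2 g \<in> H \<alpha>" using bound by (intro mem_HI) simp
  with eq show ?thesis by blast
qed

section \<open>The normalized sines as an orthonormal basis of \<open>H \<alpha>\<close>\<close>

definition sine_basis :: "real \<Rightarrow> nat \<Rightarrow> l2" where
  "sine_basis \<alpha> n = abs_l2 (\<lambda>x. complex_of_real (sqrt 2 / real n powr \<alpha> * sin (real n * pi * x)))"

lemma wcoeff_sine_basis:
  assumes "n \<ge> 1"
  shows "wcoeff \<alpha> (sine_basis \<alpha> n) = (\<lambda>m. if m = n then 1 else 0)"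
proof
  fix m
  show "wcoeff \<alpha> (sine_basis \<alpha> n) m = (if m = n then 1 else 0)"
  proof (cases "m = 0")
    case False
    have eq: "(\<lambda>x. complex_of_real (sqrt 2 / real n powr \<alpha> * sin (real n * pi * x))) =
        sine_sum {n} (\<lambda>_. complex_of_real (1 / real n powr \<alpha>))"
      by (simp add: sine_sum_def fun_eq_iff)
    have "sine_coeff (sine_basis \<alpha> n) m =
        (if m \<in> {n} then complex_of_real (1 / real n powr \<alpha>) else 0)"
      unfolding sine_basis_def eq using False
      by (subst sine_coeff_abs_l2) (auto intro!: square_integrable_continuous continuous_intros
          simp: integral_sine_sum_mult_sin simp del: of_real_mult of_real_divide)
    then show ?thesis using assms by (simp add: wcoeff_def)
  qed (use assms in simp)
qed

lemma orthonormal_basis_sine_basis: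
  "orthonormal_basis scale_l2 (H \<alpha>) (H_inner \<alpha>) (sine_basis \<alpha>)"
  unfolding orthonormal_basis_def
proof (intro conjI allI impI ballI)
  fix n :: nat assume n: "n \<ge> 1"
  have *: "(\<lambda>m. cmod (if m = n then 1 else 0)) = (\<lambda>m. if m = n then 1 else 0)" by auto
  have "trunc_norm N (wcoeff \<alpha> (sine_basis \<alpha> n)) \<le> 1" for N
    unfolding wcoeff_sine_basis[OF n] trunc_norm_def *
    by (rule order_trans[OF L2_set_le_sum]) auto
  then show "sine_basis \<alpha> n \<in> H \<alpha>" by (rule mem_HI)
next
  fix m n :: nat assume mn: "m \<ge> 1" "n \<ge> 1"
  have "H_inner \<alpha> (sine_basis \<alpha> m) (sine_basis \<alpha> n) =
     (\<Sum>\<^sub>\<infinity>k\<in>{1..}. (if k = m then 1 else 0) * cnj (if k = n then 1 else 0))"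
    by (simp only: H_inner_eq wcoeff_sine_basis mn)
  also have "\<dots> = (if m = n then 1 else 0)"
    using mn by (subst infsum_cong_neutral[where T = "{m}" and g = "\<lambda>k. if m = n then 1 else 0"]) auto
  finally show "H_inner \<alpha> (sine_basis \<alpha> m) (sine_basis \<alpha> n) = (if m = n then 1 else 0)" .
next
  fix x and \<epsilon> :: real assume x: "x \<in> H \<alpha>" and \<epsilon>: "\<epsilon> > 0"
  let ?a = "wcoeff \<alpha> x"
  define s where "s = (\<lambda>N. \<Sum>n=1..N. (cmod (?a n))\<^sup>2)"
  have "incseq s" unfolding s_def by (intro incseq_SucI) simp
  moreover have "s N \<le> (\<Sum>\<^sub>\<infinity>n\<in>{1..}. (cmod (?a n))\<^sup>2)" for N
    unfolding s_def using x by (intro finite_sum_le_infsum) (auto simp: mem_H_iff_summable)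
  ultimately have "Cauchy s"
    by (intro LIMSEQ_imp_Cauchy[OF LIMSEQ_incseq_SUP]) (auto simp: bdd_above_def)
  \<comment> \<open>Truncated norms yield only a weak inequality in the end; aiming at half of
    \<open>\<epsilon>\<close> makes it strict.\<close>
  then obtain M where M: "\<And>m n. m \<ge> M \<Longrightarrow> n \<ge> M \<Longrightarrow> norm (s m - s n) < (\<epsilon> / 2)\<^sup>2"
    using CauchyD[of s "(\<epsilon> / 2)\<^sup>2"] \<epsilon> by auto
  define y where "y = x - (\<Sum>n=1..M. scale_l2 (?a n) (sine_basis \<alpha> n))"
  have y: "wcoeff \<alpha> y m = (if m \<in> {1..M} then 0 else ?a m)" for m
  proof -
    have "(\<Sum>n=1..M. wcoeff \<alpha> (scale_l2 (?a n) (sine_basis \<alpha> n)) m) =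
        (\<Sum>n=1..M. if m = n then ?a n else 0)"
      by (intro sum.cong) (auto simp: wcoeff_scale wcoeff_sine_basis)
    then show ?thesis by (auto simp: y_def wcoeff_diff wcoeff_sum)
  qed
  have "trunc_norm N (wcoeff \<alpha> y) \<le> \<epsilon> / 2" for N
  proof -
    have "{1..max M N} = {1..M} \<union> {M<..max M N}" by auto
    then have s: "s (max M N) = s M + (\<Sum>n\<in>{M<..max M N}. (cmod (?a n))\<^sup>2)"
      unfolding s_def by (simp only:) (subst sum.union_disjoint, auto)
    have "(\<Sum>n=1..N. (cmod (wcoeff \<alpha> y n))\<^sup>2) = (\<Sum>n\<in>{M<..N}. (cmod (?a n))\<^sup>2)"
      by (intro sum.mono_neutral_cong_right) (auto simp: y)
    also have "\<dots> \<le> (\<Sum>n\<in>{M<..max M N}. (cmod (?a n))\<^sup>2)"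
      by (intro sum_mono2) auto
    also have "\<dots> \<le> (\<epsilon> / 2)\<^sup>2"
      using s M[of "max M N" M] by simp
    finally show ?thesis
      using \<epsilon> unfolding trunc_norm_def L2_set_def by (intro real_le_lsqrt) auto
  qed
  then have "ip_norm (H_inner \<alpha>) y \<le> \<epsilon> / 2" by (rule ip_norm_H_le)
  then have "ip_norm (H_inner \<alpha>) y < \<epsilon>" using \<epsilon> by simp
  then show "\<exists>N c. ip_norm (H_inner \<alpha>) (x - (\<Sum>n=1..N. scale_l2 (c n) (sine_basis \<alpha> n))) < \<epsilon>"
    unfolding y_def by (intro exI)
qed

text \<open>The map \<open>wcoeff \<alpha>\<close> identifies \<open>H \<alpha>\<close> with the square-summable sequences vanishing at \<open>0\<close>.\<close>

lemma riesz_basis_if_sequence_isomorphism: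
  assumes \<alpha>: "\<alpha> \<ge> 0"
    and add: "\<And>a b. \<Phi> (\<lambda>n. a n + b n) = (\<lambda>n. \<Phi> a n + \<Phi> b n)"
    and scale: "\<And>c a. \<Phi> (\<lambda>n. c * a n) = (\<lambda>n. c * \<Phi> a n)"
    and at_0: "\<And>a. \<Phi> a 0 = a 0"
    and surj: "\<And>b. \<exists>a. \<Phi> a = b"
    and upper: "\<And>N a. trunc_norm N (\<Phi> a) \<le> K * trunc_norm N a"
    and lower: "\<And>N a. trunc_norm N a \<le> C * trunc_norm N (\<Phi> a)"
    and nonneg: "0 \<le> K" "0 \<le> C"
    and v: "\<And>n. n \<ge> 1 \<Longrightarrow> wcoeff \<alpha> (v n) = \<Phi> (\<lambda>m. if m = n then 1 else 0)"
  shows "riesz_basis scale_l2 (H \<alpha>) (H_inner \<alpha>) v"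
proof -
  let ?a = "wcoeff \<alpha>" and ?nrm = "ip_norm (H_inner \<alpha>)"
  \<comment> \<open>The lower bound forces the positive entries of the difference to vanish; it does
    not see index 0, where \<open>at_0\<close> takes over.\<close>
  have inj: "a = b" if eq: "\<Phi> a = \<Phi> b" for a b
  proof
    fix n
    let ?d = "\<lambda>n. a n + (-1) * b n"
    have d: "\<Phi> ?d = (\<lambda>n. 0)" using eq by (simp only: add scale) simp
    have "cmod (?d n) \<le> trunc_norm n ?d" if "n \<ge> 1"
      unfolding trunc_norm_def using that by (intro member_le_L2_set) auto
    moreover have "trunc_norm n ?d \<le> 0"
      using lower[of n ?d] unfolding d by (simp add: trunc_norm_def L2_set_0')
    ultimately have "cmod (?d n) \<le> 0" if "n \<ge> 1" using that by linarith
    then show "a n = b n" using fun_cong[OF eq, of 0] at_0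
      by (cases "n = 0") auto
  qed
  have "\<exists>g\<in>H \<alpha>. ?a g = \<Phi> (?a f)" if "f \<in> H \<alpha>" for f
  proof (rule ex_wcoeff[OF \<alpha>])
    show "trunc_norm N (\<Phi> (?a f)) \<le> K * ?nrm f" for N
      using nonneg by (intro order_trans[OF upper] mult_left_mono trunc_norm_le_ip_norm that)
  qed (simp add: at_0)
  then obtain T where T: "\<And>f. f \<in> H \<alpha> \<Longrightarrow> T f \<in> H \<alpha>" "\<And>f. f \<in> H \<alpha> \<Longrightarrow> ?a (T f) = \<Phi> (?a f)"
    by metis
  \<comment> \<open>The preimage under \<open>\<Phi>\<close> is first an arbitrary sequence; the
    lower bound then shows it to be square-summable.\<close>
  have "\<exists>f\<in>H \<alpha>. \<Phi> (?a f) = ?a g" if g: "g \<in> H \<alpha>" for g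
  proof -
    obtain a where a: "\<Phi> a = ?a g" using surj by blast
    have "a 0 = 0" using at_0[of a] a by simp
    moreover have "trunc_norm N a \<le> C * ?nrm g" for N
      using nonneg lower[of N a] unfolding a
      by (meson mult_left_mono order_trans trunc_norm_le_ip_norm g)
    ultimately show ?thesis using ex_wcoeff[OF \<alpha>, of a] a by metis
  qed
  then obtain S where S: "\<And>f. f \<in> H \<alpha> \<Longrightarrow> S f \<in> H \<alpha>" "\<And>f. f \<in> H \<alpha> \<Longrightarrow> \<Phi> (?a (S f)) = ?a f"
    by metis
  have H_add: "f + g \<in> H \<alpha>" if "f \<in> H \<alpha>" "g \<in> H \<alpha>" for f g
    using that
    by (intro mem_HI[of _ _ "?nrm f + ?nrm g"])
      (auto simp: wcoeff_add intro!: order_trans[OF trunc_norm_add] add_mono trunc_norm_le_ip_norm)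
  have H_scale: "scale_l2 c f \<in> H \<alpha>" if "f \<in> H \<alpha>" for c f
  proof (rule mem_HI)
    fix N
    have "trunc_norm N (?a (scale_l2 c f)) = cmod c * trunc_norm N (?a f)"
      by (simp add: wcoeff_scale trunc_norm_def norm_mult L2_set_right_distrib)
    then show "trunc_norm N (?a (scale_l2 c f)) \<le> cmod c * ?nrm f"
      using that by (simp add: mult_left_mono trunc_norm_le_ip_norm)
  qed
  have "bounded_operator_on scale_l2 (H \<alpha>) (H_inner \<alpha>) T"
    unfolding bounded_operator_on_def
  proof (intro conjI ballI allI exI)
    show "T (f + g) = T f + T g" if "f \<in> H \<alpha>" "g \<in> H \<alpha>" for f g
      by (rule wcoeff_inject[of \<alpha>]) (simp add: T H_add that wcoeff_add add)
    show "T (scale_l2 c f) = scale_l2 c (T f)" if "f \<in> H \<alpha>" for c f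
      by (rule wcoeff_inject[of \<alpha>]) (simp add: T H_scale that wcoeff_scale scale)
    show "?nrm (T f) \<le> K * ?nrm f" if "f \<in> H \<alpha>" for f
      using nonneg by (intro ip_norm_H_le)
        (simp only: T that, intro order_trans[OF upper] mult_left_mono trunc_norm_le_ip_norm that)
  qed (rule T)
  moreover have "bounded_operator_on scale_l2 (H \<alpha>) (H_inner \<alpha>) S"
    unfolding bounded_operator_on_def
  proof (intro conjI ballI allI exI)
    \<comment> \<open>Since \<open>S\<close> is known only through \<open>\<Phi>\<close> of its
      coordinates, its identities are checked after applying the injective
      \<open>\<Phi>\<close>.\<close>
    show "S (f + g) = S f + S g" if "f \<in> H \<alpha>" "g \<in> H \<alpha>" for f g
      by (rule wcoeff_inject[of \<alpha>], rule inj) (simp add: S H_add that wcoeff_add add)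
    show "S (scale_l2 c f) = scale_l2 c (S f)" if "f \<in> H \<alpha>" for c f
      by (rule wcoeff_inject[of \<alpha>], rule inj) (simp add: S H_scale that wcoeff_scale scale)
    show "?nrm (S f) \<le> C * ?nrm f" if f: "f \<in> H \<alpha>" for f
    proof (rule ip_norm_H_le)
      show "trunc_norm N (?a (S f)) \<le> C * ?nrm f" for N
        using lower[of N "?a (S f)"] nonneg unfolding S(2)[OF f]
        by (meson mult_left_mono order_trans trunc_norm_le_ip_norm f)
    qed
  qed (rule S)
  moreover have "S (T f) = f \<and> T (S f) = f" if "f \<in> H \<alpha>" for f
  proof
    show "S (T f) = f"
      by (rule wcoeff_inject[of \<alpha>], rule inj) (simp add: S T that)
    show "T (S f) = f"
      by (rule wcoeff_inject[of \<alpha>]) (simp add: S T that)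
  qed
  moreover have "v n = T (sine_basis \<alpha> n)" if n: "n \<ge> 1" for n
  proof (rule wcoeff_inject[of \<alpha>])
    have "sine_basis \<alpha> n \<in> H \<alpha>"
      using orthonormal_basis_sine_basis n by (simp add: orthonormal_basis_def)
    then show "?a (v n) = ?a (T (sine_basis \<alpha> n))"
      by (simp only: T v wcoeff_sine_basis n)
  qed
  ultimately show ?thesis
    unfolding riesz_basis_def using orthonormal_basis_sine_basis by blast
qed

section \<open>Coordinates of the functions \<open>w_fun\<close>\<close>

lemma integral_lacunary_series_mult_sin:
  assumes l: "0 < l" "l < 1" and m: "m \<ge> 1" and p: "p \<ge> 2"
  shows "(\<integral>x. W p l (real n * x) * (sqrt 2 * sin (real m * pi * x)) \<partial>unit_leb) =
    (\<Sum>j\<le>m. if p ^ j * n = m then l ^ j else 0)"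
proof -
  \<comment> \<open>The terms of the integrand, dominated by \<open>2 * l ^ j\<close>. The factor 2
    comes from the two roots and cancels the \<open>1 / 2\<close> in
    \<open>integral_sin_mult_sin\<close>.\<close>
  define f where "f = (\<lambda>j x. 2 * l ^ j * (sin (real (p ^ j * n) * pi * x) * sin (real m * pi * x)))"
  have f_le: "norm (f j x) \<le> 2 * l ^ j" for j x
  proof -
    have "\<bar>sin (real (p ^ j * n) * pi * x)\<bar> * \<bar>sin (real m * pi * x)\<bar> \<le> 1 * 1"
      by (intro mult_mono) auto
    then show ?thesis using l by (simp add: f_def abs_mult mult_left_le)
  qed
  have summ: "summable (\<lambda>j. 2 * l ^ j)"
    using l by (intro summable_mult summable_geometric) auto
  have int: "integrable unit_leb (f j)" for j
    unfolding f_def by (intro integrable_unit_leb_continuous continuous_intros)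
  have summ_f: "summable (\<lambda>j. norm (f j x))" for x
    by (rule summable_comparison_test'[OF summ]) (use f_le in auto)
  have "W p l (real n * x) * (sqrt 2 * sin (real m * pi * x)) = (\<Sum>j. f j x)" for x
  proof -
    let ?t = "\<lambda>j. l ^ j * sin (real (p ^ j) * pi * (real n * x))"
    have "summable ?t"
      by (rule summable_comparison_test'[of "\<lambda>j. l ^ j"])
        (use l in \<open>auto simp: abs_mult mult_left_le intro!: summable_geometric\<close>)
    then have "suminf ?t * (2 * sin (real m * pi * x)) = (\<Sum>j. ?t j * (2 * sin (real m * pi * x)))"
      by (rule suminf_mult2)
    also have "\<dots> = (\<Sum>j. f j x)"
      by (simp add: f_def algebra_simps)
    finally have "(sqrt 2 * sqrt 2) * (suminf ?t * sin (real m * pi * x)) = (\<Sum>j. f j x)"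
      by (simp add: mult_ac)
    then show ?thesis by (simp only: W_def mult_ac)
  qed
  then have "(\<integral>x. W p l (real n * x) * (sqrt 2 * sin (real m * pi * x)) \<partial>unit_leb) =
      (\<integral>x. (\<Sum>j. f j x) \<partial>unit_leb)" by simp
  also have "\<dots> = (\<Sum>j. \<integral>x. f j x \<partial>unit_leb)"
  proof (rule integral_suminf[OF int])
    show "AE x in unit_leb. summable (\<lambda>j. norm (f j x))" using summ_f by simp
    show "summable (\<lambda>j. \<integral>x. norm (f j x) \<partial>unit_leb)"
    proof (rule summable_comparison_test'[OF summ])
      fix j
      have "(\<integral>x. norm (f j x) \<partial>unit_leb) \<le> (\<integral>x. 2 * l ^ j \<partial>unit_leb)"
        by (intro integral_mono integrable_norm int f_le integrable_unit_leb_continuous continuous_intros)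
      then show "norm (\<integral>x. norm (f j x) \<partial>unit_leb) \<le> 2 * l ^ j"
        by (simp add: measure_restrict_space)
    qed
  qed
  also have "\<dots> = (\<Sum>j. if p ^ j * n = m then l ^ j else 0)"
    unfolding f_def using m
    by (simp only: integral_mult_right_zero integral_sin_mult_sin) (simp add: if_distrib cong: if_cong)
  also have "\<dots> = (\<Sum>j\<le>m. if p ^ j * n = m then l ^ j else 0)"
  proof (intro suminf_finite)
    fix j assume "j \<notin> {..m}"
    then have "m < j" by simp
    also have "j < 2 ^ j" by simp
    also have "2 ^ j \<le> p ^ j" using p by (rule power_mono) simp
    finally have "m < p ^ j" .
    then have "p ^ j * n \<noteq> m" using m by (cases n) auto
    then show "(if p ^ j * n = m then l ^ j else 0) = 0" by simp
  qed simp
  finally show ?thesis .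
qed

text \<open>At \<open>m = p ^ j * n\<close> the ratio of the weights at \<open>m\<close> and
  \<open>n\<close> is \<open>(real p powr \<alpha>) ^ j\<close>. It combines with
  \<open>lam n ^ j\<close> to the \<open>j\<close>-th power of the weight in the dilation
  series.\<close>

lemma wcoeff_w:
  assumes l: "0 < lam n" "lam n < 1" and n: "n \<ge> 1" and p: "p \<ge> 2"
  shows "wcoeff \<alpha> (w p \<alpha> lam n) =
    dilation_series p (\<lambda>k. real p powr \<alpha> * lam k) (\<lambda>m. if m = n then 1 else 0)"
proof
  fix m
  show "wcoeff \<alpha> (w p \<alpha> lam n) m =
    dilation_series p (\<lambda>k. real p powr \<alpha> * lam k) (\<lambda>m. if m = n then 1 else 0) m"
  proof (cases "m = 0")
    case True
    then show ?thesis using n by (simp add: dilation_series_def)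
  next
    case False
    then have m: "m \<ge> 1" by simp
    have pow: "real (p ^ j * n) powr \<alpha> = (real p powr \<alpha>) ^ j * real n powr \<alpha>" for j
      by (induction j) (auto simp: powr_mult mult.assoc)
    have "sine_coeff (w p \<alpha> lam n) m = complex_of_real (1 / real n powr \<alpha> *
        (\<integral>x. W p (lam n) (real n * x) * (sqrt 2 * sin (real m * pi * x)) \<partial>unit_leb))"
      unfolding w_def sine_coeff_abs_l2[OF square_integrable_w_fun[of lam n, OF l]]
      unfolding w_fun_def of_real_mult[symmetric] integral_complex_of_real mult.assoc integral_mult_right_zero ..
    then have "wcoeff \<alpha> (w p \<alpha> lam n) m = complex_of_real
        (real m powr \<alpha> * (1 / real n powr \<alpha>) * (\<Sum>j\<le>m. if p ^ j * n = m then lam n ^ j else 0))"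
      unfolding integral_lacunary_series_mult_sin[OF l m p] by (simp add: wcoeff_def)
    also have "\<dots> = (\<Sum>j\<le>m. complex_of_real (if p ^ j * n = m then real m powr \<alpha> * (1 / real n powr \<alpha>) * lam n ^ j else 0))"
      by (simp only: sum_distrib_left of_real_sum) (intro sum.cong, auto)
    also have "\<dots> = (\<Sum>j\<le>m. dilate p (\<lambda>k. real p powr \<alpha> * lam k) j (\<lambda>m. if m = n then 1 else 0) m)"
    proof (intro sum.cong refl)
      fix j
      show "complex_of_real (if p ^ j * n = m then real m powr \<alpha> * (1 / real n powr \<alpha>) * lam n ^ j else 0) =
          dilate p (\<lambda>k. real p powr \<alpha> * lam k) j (\<lambda>m. if m = n then 1 else 0) m"
      proof (cases "p ^ j * n = m")
        case True
        then show ?thesis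
          using n p pow[of j] by (auto simp: dilate_def power_mult_distrib)
      next
        case False
        then show ?thesis by (auto simp: dilate_def)
      qed
    qed
    finally show ?thesis by (simp add: dilation_series_def)
  qed
qed

section \<open>The Riesz basis property for \<open>S0\<close> and \<open>S1\<close>\<close>

theorem theorem4p1:
  fixes \<alpha> :: real and p :: nat and lam :: "nat \<Rightarrow> real"
  assumes "\<alpha> \<ge> 0" and "p > 0" and "p \<noteq> 1"
    and "lam \<in> S0 p \<alpha> \<union> S1 p \<alpha>"
  shows "riesz_basis scale_l2 (H \<alpha>) (H_inner \<alpha>) (w p \<alpha> lam)"
proof -
  have p: "p \<ge> 2" using assms by linarith
  define P where "P = real p powr \<alpha>"
  have P: "P \<ge> 1" unfolding P_def using assms by (intro ge_one_powr_ge_zero) auto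
  define \<mu> where "\<mu> = (\<lambda>k. P * lam k)"
  define s where "s = P * (SUP n\<in>{1..}. lam n)"
  \<comment> \<open>The right endpoint \<open>B\<close> bounds the sequence, so the supremum really
    is an upper bound.\<close>
  have le_SUP: "lam n \<le> (SUP n\<in>{1..}. lam n)" if "n \<ge> 1" "lam \<in> seqs {0<..<B}" for n B
    using that by (intro cSUP_upper bdd_aboveI2[of _ _ B]) (auto simp: seqs_def less_imp_le)
  have seqs: "lam \<in> seqs {0<..<1 / P} \<or> lam \<in> seqs {0<..<1 / (2 * P)}"
    using assms by (auto simp: S0_def S1_def P_def)
  then have lam: "0 < lam n" "lam n < 1 / P" "lam n \<le> (SUP n\<in>{1..}. lam n)" if "n \<ge> 1" for n
  proof -
    have "1 / (2 * P) \<le> 1 / P" using P by (simp add: field_simps)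
    then show "0 < lam n" "lam n < 1 / P" using seqs that by (fastforce simp: seqs_def)+
    show "lam n \<le> (SUP n\<in>{1..}. lam n)" using seqs le_SUP that by blast
  qed
  have lam1: "lam n < 1" if "n \<ge> 1" for n
    using lam(2)[OF that] P by (simp add: less_le_trans)
  have \<mu>: "0 \<le> \<mu> n \<and> \<mu> n \<le> s" if "n \<ge> 1" for n
    using lam[OF that] P by (simp add: \<mu>_def s_def)
  have s0: "0 \<le> s" using \<mu>[of 1] by linarith
  \<comment> \<open>Multiplying by \<open>P\<close> rescales the suprema: \<open>S0\<close> gives
    \<open>s < 1 / 2\<close>, while \<open>S1\<close> gives \<open>s < 1\<close> together with
    invariance.\<close>
  have s: "s < 1 / 2 \<or> (s < 1 \<and> (\<forall>n\<ge>1. \<mu> n = \<mu> (p * n)))"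
    using assms P unfolding S0_def S1_def P_def[symmetric] s_def \<mu>_def by (auto simp: field_simps)
  then have s1: "s < 1" by auto
  obtain C where C: "0 \<le> C" "\<And>N a. trunc_norm N a \<le> C * trunc_norm N (dilation_series p \<mu> a)"
    using s
  proof
    assume "s < 1 / 2"
    then show ?thesis
      using that[of "(1 - s) / (1 - 2 * s)"] trunc_norm_le_dilation_series_small[OF p \<mu>] by auto
  next
    assume "s < 1 \<and> (\<forall>n\<ge>1. \<mu> n = \<mu> (p * n))"
    then show ?thesis
      using that[of "1 + s"] trunc_norm_le_dilation_series_invariant[OF p \<mu>] s0 by auto
  qed
  show ?thesis
  proof (rule riesz_basis_if_sequence_isomorphism[where \<Phi> = "dilation_series p \<mu>" and C = C])
    show "\<exists>a. dilation_series p \<mu> a = b" for b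
      using dilation_series_surj[OF p] by blast
    show "wcoeff \<alpha> (w p \<alpha> lam n) = dilation_series p \<mu> (\<lambda>m. if m = n then 1 else 0)" if "n \<ge> 1" for n
      using wcoeff_w[of lam n p \<alpha>] lam(1) lam1 p that by (simp add: \<mu>_def P_def)
    show "trunc_norm N (dilation_series p \<mu> a) \<le> 1 / (1 - s) * trunc_norm N a" for N a
      by (rule trunc_norm_dilation_series[OF p \<mu> s1])
    show "dilation_series p \<mu> a 0 = a 0" for a by (simp add: dilation_series_def)
    show "0 \<le> 1 / (1 - s)" using s1 by simp
  qed (use assms C in \<open>auto simp: dilation_series_add dilation_series_scale fun_eq_iff\<close>)
qed

end
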